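(* Let $\mathrm{BUC}=\mathrm{BUC}(\mathbb{R})$ and let $S$ be the uncertain shift semigroup on $\mathrm{BUC}$, $\big(S(t)f\big)(x)=\sup_{|y|\le t}f(x+y)$ for $f\in\mathrm{BUC}$, $x\in\mathbb{R}$, $t\ge0$, with generator $A$, monotone generator $A_\delta$, Lipschitz set $D_L$ and symmetric Lipschitz set $D_L^s$. Then \[\mathrm{BUC}^1\subset D(A)\subset D(A_\delta)\subset D_L=D_L^s=W^{1,\infty}.\] In particular, $S(t)f\in W^{1,\infty}$ for every $f\in W^{1,\infty}$ and all $t\ge0$. Further, for $f\in D(A_\delta)$, one has $A_\delta f=|f'|$ almost everywhere.
   Context: $\mathrm{BUC}$ is the Banach lattice of bounded uniformly continuous functions $\mathbb{R}\to\mathbb{R}$ with the supremum norm $\|\cdot\|_\infty$ and pointwise order, viewed as a Riesz subspace of the Dedekind $\sigma$-complete space $\mathcal{L}^\infty$ of bounded Borel measurable functions $\mathbb{R}\to\mathbb{R}$ with the pointwise order. $\mathrm{BUC}^1$ is the space of $f\in\mathrm{BUC}$ that are differentiable with $f'\in\mathrm{BUC}$. $W^{1,\infty}=W^{1,\infty}(\mathbb{R})$ is the space of bounded functions with weak derivative $f'\in L^\infty$ (Lebesgue measure); it is identified with the space of bounded Lipschitz continuous functions. $S$ is a sublinear monotone strongly continuous semigroup on $\mathrm{BUC}$. For functions $g_n,g$, write $g_n\downarrow g$ if $(g_n)_{n\in\mathbb{N}}$ is decreasing, bounded from below, and $g=\inf_ng_n$ (pointwise). $\mathrm{BUC}_\delta$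 is the set of all $g\in\mathcal{L}^\infty$ with $g_n\downarrow g$ for some sequence $(g_n)$ in $\mathrm{BUC}$ (i.e. the bounded upper semicontinuous functions). $D(A)$ is the set of all $f\in\mathrm{BUC}$ such that $\frac{S(h)f-f}{h}$ converges in $\mathrm{BUC}$ (uniformly) as $h\downarrow0$, and $Af$ is the limit. $D(A_\delta)$ is the set of all $f\in\mathrm{BUC}$ such that for every sequence $(h_n)$ in $(0,\infty)$ with $h_n\downarrow0$ there exist a sequence $(A_nf)_{n\in\mathbb{N}}$ in $\mathrm{BUC}$ and some $g\in\mathrm{BUC}_\delta$ with $\big\|\frac{S(h_n)f-f}{h_n}-A_nf\big\|_\infty\to0$ and $A_nf\downarrow g$; then $g$ is uniquely determined and $A_\delta f:=g$. The Lipschitz set is $D_L:=\{f\in\mathrm{BUC}\colon\sup_{h\in(0,h_0]}\|\frac{S(h)f-f}{h}\|_\infty<\infty\text{ for some }h_0>0\}$, and $D_L^s:=\{f\in\mathrm{BUC}\colon f,-f\in D_L\}$. *)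

theory Defs
  imports "HOL-Analysis.Analysis"
begin

section \<open>Function spaces on the real line\<close>

definition BUC :: "(real \<Rightarrow> real) set" where
  "BUC = {f. bounded (range f) \<and> uniformly_continuous_on UNIV f}"

text \<open>Only meaningful for bounded \<open>f\<close>: the supremum of an unbounded set of reals is unspecified.\<close>
definition sup_norm :: "(real \<Rightarrow> real) \<Rightarrow> real" where
  "sup_norm f = (SUP x. \<bar>f x\<bar>)"

definition BUC1 :: "(real \<Rightarrow> real) set" where
  "BUC1 = {f \<in> BUC. \<exists>f' \<in> BUC. \<forall>x. (f has_real_derivative f' x) (at x)}"

text \<open>Monotone convergence \<open>g\<^sub>n \<down> g\<close>. The lower bound is a constant, i.e. the sequence is
  order bounded below in the Riesz space of bounded functions.\<close>
definition decreases_to :: "(nat \<Rightarrow> real \<Rightarrow> real) \<Rightarrow> (real \<Rightarrow> real) \<Rightarrow> bool" where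
  "decreases_to gs g \<longleftrightarrow>
     decseq gs \<and> (\<exists>c. \<forall>n x. c \<le> gs n x) \<and> g = (\<lambda>x. INF n. gs n x)"

definition BUC_delta :: "(real \<Rightarrow> real) set" where
  "BUC_delta = {g \<in> borel_measurable borel. bounded (range g) \<and>
     (\<exists>gs. (\<forall>n. gs n \<in> BUC) \<and> decreases_to gs g)}"


section \<open>The Sobolev space of order one and exponent infinity\<close>

definition L_infty :: "(real \<Rightarrow> real) set" where
  "L_infty = {f \<in> borel_measurable lebesgue. \<exists>C. AE x in lebesgue. \<bar>f x\<bar> \<le> C}"

definition test_functions :: "(real \<Rightarrow> real) set" where
  "test_functions =
     {\<phi>. (\<forall>n x. (deriv ^^ n) \<phi> differentiable (at x)) \<and> compact (closure {x. \<phi> x \<noteq> 0})}"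

definition has_weak_derivative :: "(real \<Rightarrow> real) \<Rightarrow> (real \<Rightarrow> real) \<Rightarrow> bool" where
  "has_weak_derivative u g \<longleftrightarrow>
     (\<forall>K. compact K \<longrightarrow> set_integrable lebesgue K u \<and> set_integrable lebesgue K g) \<and>
     (\<forall>\<phi> \<in> test_functions.
        (LINT x|lebesgue. u x * deriv \<phi> x) = - (LINT x|lebesgue. g x * \<phi> x))"

text \<open>All representatives of all elements: this set is closed under almost everywhere equality.\<close>
definition W1_infty :: "(real \<Rightarrow> real) set" where
  "W1_infty = {u \<in> L_infty. \<exists>g \<in> L_infty. has_weak_derivative u g}"

text \<open>Each element of the Sobolev space, a class of functions modulo almost everywhere equality,
  is identified with its continuous representative, which is in fact Lipschitz.\<close>
definition W1_infty_rep :: "(real \<Rightarrow> real) set" where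
  "W1_infty_rep = {f \<in> W1_infty. continuous_on UNIV f}"


section \<open>Generators and Lipschitz sets of a family of operators on BUC\<close>

type_synonym operator_family = "real \<Rightarrow> (real \<Rightarrow> real) \<Rightarrow> (real \<Rightarrow> real)"

definition diff_quot :: "operator_family \<Rightarrow> real \<Rightarrow> (real \<Rightarrow> real) \<Rightarrow> real \<Rightarrow> real" where
  "diff_quot S h f = (\<lambda>x. (S h f x - f x) / h)"

definition dom_generator :: "operator_family \<Rightarrow> (real \<Rightarrow> real) set" where
  "dom_generator S = {f \<in> BUC. \<exists>g \<in> BUC.
     ((\<lambda>h. sup_norm (\<lambda>x. diff_quot S h f x - g x)) \<longlongrightarrow> 0) (at_right 0)}"

definition step_sequence :: "(nat \<Rightarrow> real) \<Rightarrow> bool" where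
  "step_sequence h \<longleftrightarrow> (\<forall>n. 0 < h n) \<and> decseq h \<and> h \<longlonglongrightarrow> 0"

definition monotone_limit_along ::
    "operator_family \<Rightarrow> (real \<Rightarrow> real) \<Rightarrow> (nat \<Rightarrow> real) \<Rightarrow> (real \<Rightarrow> real) \<Rightarrow> bool" where
  "monotone_limit_along S f h g \<longleftrightarrow> g \<in> BUC_delta \<and>
     (\<exists>gs. (\<forall>n. gs n \<in> BUC) \<and>
        (\<lambda>n. sup_norm (\<lambda>x. diff_quot S (h n) f x - gs n x)) \<longlonglongrightarrow> 0 \<and>
        decreases_to gs g)"

definition dom_monotone_generator :: "operator_family \<Rightarrow> (real \<Rightarrow> real) set" where
  "dom_monotone_generator S =
     {f \<in> BUC. \<forall>h. step_sequence h \<longrightarrow> (\<exists>g. monotone_limit_along S f h g)}"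

text \<open>In the domain the limit does not depend on the step sequence: any two step sequences have
  subsequences that interleave to a third one, and the limit is the pointwise limit of the
  difference quotients.\<close>
definition monotone_generator :: "operator_family \<Rightarrow> (real \<Rightarrow> real) \<Rightarrow> real \<Rightarrow> real" where
  "monotone_generator S f = (THE g. \<forall>h. step_sequence h \<longrightarrow> monotone_limit_along S f h g)"

definition lipschitz_set :: "operator_family \<Rightarrow> (real \<Rightarrow> real) set" where
  "lipschitz_set S =
     {f \<in> BUC. \<exists>h0>0. bdd_above ((\<lambda>h. sup_norm (diff_quot S h f)) ` {0<..h0})}"

definition symmetric_lipschitz_set :: "operator_family \<Rightarrow> (real \<Rightarrow> real) set" where
  "symmetric_lipschitz_set S =
     {f \<in> BUC. f \<in> lipschitz_set S \<and> (\<lambda>x. - f x) \<in> lipschitz_set S}"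


section \<open>The uncertain shift semigroup\<close>

definition uncertain_shift :: operator_family where
  "uncertain_shift t f = (\<lambda>x. SUP y \<in> {y. \<bar>y\<bar> \<le> t}. f (x + y))"

end

(*
  All of the sets D_L, D_L^s and W^{1,infinity} coincide with the bounded Lipschitz functions. If
  the difference quotients (S(h_n) f - f) / h_n are bounded above by c along a single sequence
  h_n -> 0, then f increases by at most c h_n over distances at most h_n, in both directions, and
  chaining such steps shows that f is c-Lipschitz.

  For c-Lipschitz f with c < L, the functions (x + f x / L) / 2 and (x - f x / L) / 2 are increasing
  with sum x, so their Stieltjes measures add up to Lebesgue measure; the Radon-Nikodym density of
  the first one yields f as an indefinite integral, hence f is differentiable almost everywhere.
  Applied to f phi for a test function phi, this shows that the pointwise derivative is a weak
  derivative. Conversely, if u has a bounded weak derivative g and G is an indefinite integral of g,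
  then u - G is almost everywhere constant by the lemma of du Bois-Reymond.

  Where f is differentiable, the difference quotients converge pointwise to |f' x|, which
  identifies the monotone generator. Its independence of the step sequence follows by interleaving.
*)
theory Submission
  imports Defs
begin

section \<open>Smooth functions and test functions\<close>

text \<open>The equality of D_L and D_L^s rests on the symmetry of the constraint |y| <= t. The
  domain of the monotone generator fits the same pattern: the approximating functions decrease, so
  the first of them bounds all from above. On the Sobolev side the obstacle is that a Lipschitz
  function is not known at the outset to be differentiable at a single point. Measures produce a
  candidate for the derivative first: if two continuous increasing functions add up to the identity,
  their Stieltjes measures are dominated by Lebesgue measure, so a density exists, and
  differentiability comes afterwards from the Lebesgue differentiation theorem. The formula for the
  monotone generator concerns an arbitrary weak derivative, not a chosen one. Uniqueness of weak
  derivatives links it to the pointwise derivative, which is why the fundamental lemma serves both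
  directions of the argument.\<close>

definition smooth :: "(real \<Rightarrow> real) \<Rightarrow> bool" where
  "smooth f \<longleftrightarrow> (\<forall>n x. (deriv ^^ n) f differentiable (at x))"

text \<open>Coinduction principle for smoothness: a set of functions, each with its derivative again
  in the set, takes the place of a formula for the iterates of \<open>deriv\<close>.\<close>

lemma smooth_if_derivative_closed:
  assumes "f \<in> X" and "\<And>f. f \<in> X \<Longrightarrow> \<exists>f'\<in>X. \<forall>x. (f has_real_derivative f' x) (at x)"
  shows "smooth f"
proof -
  have deriv: "deriv f \<in> X \<and> f differentiable (at x)" if "f \<in> X" for f x
  proof -
    from assms(2)[OF that] obtain f' where "f' \<in> X" and *: "\<forall>x. (f has_real_derivative f' x) (at x)"
      by blast
    moreover have "deriv f = f'"
      using * by (intro ext DERIV_imp_deriv) blast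
    ultimately show ?thesis
      by (metis real_differentiable_def)
  qed
  have "(deriv ^^ n) f \<in> X" for n
    by (induction n) (use assms(1) deriv in auto)
  then show ?thesis
    using deriv by (auto simp: smooth_def)
qed

lemma smooth_has_derivative:
  assumes "smooth f"
  shows "(f has_real_derivative deriv f x) (at x)"
proof -
  have "(deriv ^^ 0) f differentiable (at x)"
    using assms unfolding smooth_def by blast
  then show ?thesis
    by (simp add: DERIV_deriv_iff_real_differentiable)
qed

lemma smooth_deriv: "smooth f \<Longrightarrow> smooth (deriv f)"
  unfolding smooth_def by (metis comp_apply funpow_Suc_right)

lemma smooth_imp_continuous: "smooth f \<Longrightarrow> continuous_on A f"
  using smooth_has_derivative DERIV_continuous_on has_field_derivative_at_within by blast

lemma smooth_antiderivative:
  assumes "\<And>x. (f has_real_derivative f' x) (at x)" and "smooth f'"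
  shows "smooth f"
  by (rule smooth_if_derivative_closed[where X = "insert f {g. smooth g}"])
     (use assms smooth_has_derivative smooth_deriv in blast)+

text \<open>Unlike the set of products of two smooth functions, this set is closed under derivatives.\<close>
inductive_set smooth_span :: "(real \<Rightarrow> real) set" where
  prod: "smooth f \<Longrightarrow> smooth g \<Longrightarrow> (\<lambda>x. f x * g x) \<in> smooth_span"
| sum: "f \<in> smooth_span \<Longrightarrow> g \<in> smooth_span \<Longrightarrow> (\<lambda>x. f x + g x) \<in> smooth_span"

lemma smooth_span_imp_smooth:
  assumes "f \<in> smooth_span"
  shows "smooth f"
  using assms
proof (rule smooth_if_derivative_closed)
  fix f assume "f \<in> smooth_span"
  then show "\<exists>f'\<in>smooth_span. \<forall>x. (f has_real_derivative f' x) (at x)"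
  proof induction
    case (prod f g)
    have "((\<lambda>x. f x * g x) has_real_derivative f x * deriv g x + deriv f x * g x) (at x)" for x
      using prod[THEN smooth_has_derivative, of x] by (auto intro!: derivative_eq_intros)
    moreover have "(\<lambda>x. f x * deriv g x + deriv f x * g x) \<in> smooth_span"
      using prod by (intro smooth_span.intros smooth_deriv)
    ultimately show ?case by (rule_tac bexI)  auto
  next
    case (sum f g)
    then obtain f' g' where "f' \<in> smooth_span" "g' \<in> smooth_span"
      "\<forall>x. (f has_real_derivative f' x) (at x)" "\<forall>x. (g has_real_derivative g' x) (at x)"
      by blast
    then show ?case
      by (intro bexI[of _ "\<lambda>x. f' x + g' x"]) (auto intro!: DERIV_add smooth_span.sum)
  qed
qed

lemma smooth_mult: "smooth f \<Longrightarrow> smooth g \<Longrightarrow> smooth (\<lambda>x. f x * g x)"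
  by (rule smooth_span_imp_smooth, rule smooth_span.prod)

lemma smooth_const: "smooth (\<lambda>x. c)"
  by (rule smooth_if_derivative_closed[where X = "range (\<lambda>c x. c)"]) (auto intro!: exI[of _ 0])

lemma smooth_diff:
  assumes "smooth f" "smooth g"
  shows "smooth (\<lambda>x. f x - g x)"
proof -
  have "(\<lambda>x. f x * 1 + (-1) * g x) \<in> smooth_span"
    using assms smooth_const by (intro smooth_span.intros)
  then show ?thesis
    using smooth_span_imp_smooth by fastforce
qed

lemma smooth_affine:
  assumes "smooth f"
  shows "smooth (\<lambda>x. f (a + s * x))"
\<comment> \<open>The coefficient \<open>c\<close> absorbs the factor \<open>s\<close> that each
  application of the chain rule produces.\<close>
proof (rule smooth_if_derivative_closed[where X = "{\<lambda>x. c * f (a + s * x) |c f. smooth f}"])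
  show "(\<lambda>x. f (a + s * x)) \<in> {\<lambda>x. c * f (a + s * x) |c f. smooth f}"
    using assms by (auto intro!: exI[of _ 1] exI[of _ f])
next
  fix g assume "g \<in> {\<lambda>x. c * f (a + s * x) |c f. smooth f}"
  then obtain c h where h: "smooth h" and g: "g = (\<lambda>x. c * h (a + s * x))"
    by blast
  have "(g has_real_derivative (c * s) * deriv h (a + s * x)) (at x)" for x
    unfolding g
    by (auto intro!: derivative_eq_intros DERIV_chain2[OF smooth_has_derivative[OF h]])
  then show "\<exists>g'\<in>{\<lambda>x. c * f (a + s * x) |c f. smooth f}. \<forall>x. (g has_real_derivative g' x) (at x)"
    using smooth_deriv[OF h]
    by (intro bexI[of _ "\<lambda>x. (c * s) * deriv h (a + s * x)"]) auto
qed

section \<open>Flat functions and bumps\<close>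

definition flat_exp :: "real poly \<Rightarrow> real \<Rightarrow> real" where
  "flat_exp p x = (if 0 < x then poly p (inverse x) * exp (- inverse x) else 0)"

lemma poly_div_exp_tendsto_0: "((\<lambda>x::real. poly p x * exp (- x)) \<longlongrightarrow> 0) at_top"
proof -
  have "((\<lambda>x. \<Sum>i\<le>degree p. coeff p i * (x ^ i / exp x)) \<longlongrightarrow> (\<Sum>i\<le>degree p. coeff p i * 0)) at_top"
    by (intro tendsto_intros tendsto_power_div_exp_0)
  then show ?thesis
    by (simp add: poly_altdef exp_minus sum_distrib_right sum_divide_distrib field_simps)
qed

text \<open>The polynomial parameter makes the family closed under differentiation. With u = 1/x,
  the derivative of p(u) exp(-u) with respect to x is u^2 (p(u) - p'(u)) exp(-u), and
  \<open>[:0, 0, 1:]\<close> is the factor u^2.\<close>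

lemma flat_exp_has_derivative:
  "(flat_exp p has_real_derivative flat_exp ([:0, 0, 1:] * (p - pderiv p)) x) (at x)"
proof -
  consider "x < 0" | "x = 0" | "x > 0" by linarith
  then show ?thesis
  proof cases
    case 1
    have "((\<lambda>x. 0) has_real_derivative 0) (at x)" by simp
    then have "(flat_exp p has_real_derivative 0) (at x)"
      by (rule has_field_derivative_transform_within_open[where S = "{..<0}"])
         (use 1 in \<open>auto simp: flat_exp_def\<close>)
    then show ?thesis using 1 by (simp add: flat_exp_def)
  next
    case 2
    \<comment> \<open>Dividing by \<open>h\<close> multiplies by \<open>inverse h\<close>, so the
      difference quotient at 0 has the same shape with \<open>p\<close> replaced by
      \<open>pCons 0 p\<close>.\<close>
    have "((\<lambda>x. poly (pCons 0 p) (inverse x) * exp (- inverse x)) \<longlongrightarrow> 0) (at_right 0)"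
      by (rule filterlim_compose[OF poly_div_exp_tendsto_0 filterlim_inverse_at_top_right])
    then have "((\<lambda>h. (flat_exp p h - flat_exp p 0) / h) \<longlongrightarrow> 0) (at_right 0)"
      by (rule Lim_transform_eventually)
         (auto simp: eventually_at_filter flat_exp_def field_simps)
    moreover have "((\<lambda>h. (flat_exp p h - flat_exp p 0) / h) \<longlongrightarrow> 0) (at_left 0)"
      by (rule tendsto_eventually) (auto simp: eventually_at_filter flat_exp_def)
    ultimately show ?thesis
      unfolding 2 DERIV_def by (simp add: filterlim_split_at flat_exp_def)
  next
    case 3
    have "((\<lambda>x. poly p (inverse x) * exp (- inverse x)) has_real_derivative
        flat_exp ([:0, 0, 1:] * (p - pderiv p)) x) (at x)"
      using 3 by (auto intro!: derivative_eq_intros DERIV_chain2[OF poly_DERIV]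
          simp: flat_exp_def algebra_simps power2_eq_square)
    then show ?thesis
      by (rule has_field_derivative_transform_within_open[where S = "{0<..}"])
         (use 3 in \<open>auto simp: flat_exp_def\<close>)
  qed
qed

lemma smooth_flat_exp: "smooth (flat_exp p)"
  by (rule smooth_if_derivative_closed[where X = "range flat_exp"])
     (use flat_exp_has_derivative in blast)+

text \<open>On the interval from \<open>a\<close> to \<open>b\<close> this is \<open>exp (- 1 / ((k + 1) (x - a)) - 1 / ((k + 1) (b - x)))\<close>, which
  tends to \<open>1\<close>.\<close>
definition bump :: "real \<Rightarrow> real \<Rightarrow> nat \<Rightarrow> real \<Rightarrow> real" where
  "bump a b k x = flat_exp 1 (real (Suc k) * (x - a)) * flat_exp 1 (real (Suc k) * (b - x))"

lemma bump_outside: "x \<notin> {a..b} \<Longrightarrow> bump a b k x = 0"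
  by (auto simp: bump_def flat_exp_def zero_less_mult_iff simp del: of_nat_Suc)

lemma flat_exp_1_bounds: "0 \<le> flat_exp 1 x" "flat_exp 1 x \<le> 1"
  by (auto simp: flat_exp_def)

lemma bump_bounds: "0 \<le> bump a b k x" "bump a b k x \<le> 1"
  by (auto simp: bump_def intro!: mult_nonneg_nonneg mult_le_one flat_exp_1_bounds)

lemma bump_pos: "a < x \<Longrightarrow> x < b \<Longrightarrow> 0 < bump a b k x"
  by (auto simp: bump_def flat_exp_def)

lemma bump_tendsto_indicator: "(\<lambda>k. bump a b k x) \<longlonglongrightarrow> indicator {a<..<b} x"
proof (cases "x \<in> {a<..<b}")
  case True
  have lim: "(\<lambda>k. exp (- inverse (real (Suc k) * d))) \<longlonglongrightarrow> 1" for d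
  proof -
    have "(\<lambda>k. exp (- (inverse (real (Suc k)) * inverse d))) \<longlonglongrightarrow> exp (- (0 * inverse d))"
      by (intro tendsto_intros LIMSEQ_inverse_real_of_nat)
    then show ?thesis by simp
  qed
  show ?thesis
    using tendsto_mult[OF lim lim, of "x - a" "b - x"] True
    by (simp add: bump_def flat_exp_def del: of_nat_Suc)
next
  case False
  then have "bump a b k x = 0" for k
    by (auto simp: bump_def flat_exp_def zero_less_mult_iff simp del: of_nat_Suc)
  then show ?thesis using False by simp
qed

lemma test_functionsI:
  assumes "smooth \<phi>" and "\<And>x. x \<notin> {a..b} \<Longrightarrow> \<phi> x = 0"
  shows "\<phi> \<in> test_functions"
proof -
  have "closure {x. \<phi> x \<noteq> 0} \<subseteq> {a..b}"
  proof (rule closure_minimal)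
    show "{x. \<phi> x \<noteq> 0} \<subseteq> {a..b}"
      using assms(2) by blast
  qed simp
  then have "compact (closure {x. \<phi> x \<noteq> 0})"
    by (meson bounded_closed_interval bounded_subset closed_closure compact_eq_bounded_closed)
  then show ?thesis
    using assms(1) by (simp add: test_functions_def smooth_def)
qed

lemma test_functionsD:
  assumes "\<phi> \<in> test_functions"
  obtains r where "0 < r" "\<And>x. x \<notin> {-r..r} \<Longrightarrow> \<phi> x = 0"
proof -
  have "bounded {x. \<phi> x \<noteq> 0}"
    using assms unfolding test_functions_def
    by (metis (no_types, lifting) bounded_subset closure_subset compact_imp_bounded mem_Collect_eq)
  then obtain r where "0 < r" "\<forall>x\<in>{x. \<phi> x \<noteq> 0}. norm x \<le> r"
    by (metis bounded_pos)
  then show thesis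
    by (intro that[of r]) auto
qed

lemma test_functions_smooth: "\<phi> \<in> test_functions \<Longrightarrow> smooth \<phi>"
  by (simp add: test_functions_def smooth_def)

lemma bump_test: "bump a b k \<in> test_functions"
proof (rule test_functionsI[where a = a and b = b])
  have "smooth (\<lambda>x. flat_exp 1 (- real (Suc k) * a + real (Suc k) * x) *
      flat_exp 1 (real (Suc k) * b + (- real (Suc k)) * x))"
    by (intro smooth_mult smooth_affine smooth_flat_exp)
  moreover have "bump a b k = (\<lambda>x. flat_exp 1 (- real (Suc k) * a + real (Suc k) * x) *
      flat_exp 1 (real (Suc k) * b + (- real (Suc k)) * x))"
    by (simp add: bump_def fun_eq_iff algebra_simps)
  ultimately show "smooth (bump a b k)" by simp
qed (rule bump_outside)

section \<open>The fundamental lemma of the calculus of variations\<close>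

definition locally_integrable :: "(real \<Rightarrow> real) \<Rightarrow> bool" where
  "locally_integrable f \<longleftrightarrow> (\<forall>K. compact K \<longrightarrow> set_integrable lebesgue K f)"

lemma locally_integrable_diff:
  "locally_integrable f \<Longrightarrow> locally_integrable g \<Longrightarrow> locally_integrable (\<lambda>x. f x - g x)"
  by (simp add: locally_integrable_def)

lemma continuous_measurable_lebesgue:
  fixes f :: "real \<Rightarrow> real"
  shows "continuous_on UNIV f \<Longrightarrow> f \<in> borel_measurable lebesgue"
  by (intro measurable_completion) (simp add: borel_measurable_continuous_onI)

lemma locally_integrable_continuous:
  assumes f: "continuous_on UNIV f"
  shows "locally_integrable f"
  unfolding locally_integrable_def set_integrable_def
proof (intro allI impI)
  fix K :: "real set" assume "compact K"
  then have "integrable lborel (\<lambda>x. indicator K x *\<^sub>R f x)"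
    by (intro borel_integrable_compact continuous_on_subset[OF f]) auto
  then show "integrable lebesgue (\<lambda>x. indicator K x *\<^sub>R f x)"
    by (subst integrable_completion) (auto dest: borel_measurable_integrable)
qed

lemma locally_integrable_bounded:
  assumes "f \<in> borel_measurable lebesgue" and "AE x in lebesgue. \<bar>f x\<bar> \<le> C"
  shows "locally_integrable f"
  unfolding locally_integrable_def set_integrable_def
proof (intro allI impI)
  fix K :: "real set" assume K: "compact K"
  have "integrable lebesgue (\<lambda>x. C * indicator K x)"
    using K lmeasurable_compact[OF K] by (intro integrable_mult_right) (simp add: lmeasurable_iff_integrable)
  then show "integrable lebesgue (\<lambda>x. indicat_real K x *\<^sub>R f x)"
  proof (rule Bochner_Integration.integrable_bound)
    show "(\<lambda>x. indicat_real K x *\<^sub>R f x) \<in> borel_measurable lebesgue"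
      using assms(1) K
      by (intro borel_measurable_scaleR borel_measurable_indicator fmeasurableD lmeasurable_compact)
    show "AE x in lebesgue. norm (indicat_real K x *\<^sub>R f x) \<le> norm (C * indicat_real K x)"
      using assms(2) by eventually_elim (auto simp: indicator_def)
  qed
qed

lemma integrable_mult_compact_support:
  assumes "locally_integrable u" and \<phi>: "continuous_on UNIV \<phi>" "\<And>x. x \<notin> {-r..r} \<Longrightarrow> \<phi> x = 0"
  shows "integrable lebesgue (\<lambda>x. u x * \<phi> x)"
proof -
  have "bounded (\<phi> ` {-r..r})"
    by (intro compact_imp_bounded compact_continuous_image continuous_on_subset[OF \<phi>(1)]) auto
  then obtain B where B: "\<forall>x\<in>{-r..r}. \<bar>\<phi> x\<bar> \<le> B"
    unfolding bounded_iff by auto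
  have int: "integrable lebesgue (\<lambda>x. indicat_real {-r..r} x *\<^sub>R u x)"
    using assms(1) by (auto simp: locally_integrable_def set_integrable_def)
  have eq: "u x * \<phi> x = (indicat_real {-r..r} x *\<^sub>R u x) * \<phi> x" for x
    using \<phi>(2)[of x] by (auto simp: indicator_def)
  have "integrable lebesgue (\<lambda>x. (indicat_real {-r..r} x *\<^sub>R u x) * \<phi> x)"
  proof (rule Bochner_Integration.integrable_bound)
    show "integrable lebesgue (\<lambda>x. B * (indicat_real {-r..r} x *\<^sub>R u x))"
      using int by (rule integrable_mult_right)
    show "(\<lambda>x. (indicat_real {-r..r} x *\<^sub>R u x) * \<phi> x) \<in> borel_measurable lebesgue"
      by (intro borel_measurable_times borel_measurable_integrable[OF int]
          continuous_measurable_lebesgue \<phi>(1))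
    show "AE x in lebesgue. norm ((indicat_real {-r..r} x *\<^sub>R u x) * \<phi> x)
        \<le> norm (B * (indicat_real {-r..r} x *\<^sub>R u x))"
    proof (intro AE_I2)
      fix x
      show "norm ((indicat_real {-r..r} x *\<^sub>R u x) * \<phi> x) \<le> norm (B * (indicat_real {-r..r} x *\<^sub>R u x))"
      proof (cases "x \<in> {-r..r}")
        case True
        then have "\<bar>\<phi> x\<bar> \<le> \<bar>B\<bar>" using B by force
        then have "\<bar>u x\<bar> * \<bar>\<phi> x\<bar> \<le> \<bar>u x\<bar> * \<bar>B\<bar>" by (rule mult_left_mono) simp
        then show ?thesis using True by (simp add: abs_mult mult.commute)
      qed auto
    qed
  qed
  then show ?thesis by (simp only: eq)
qed

lemma AE_lebesgueI: "negligible N \<Longrightarrow> (\<And>x. x \<notin> N \<Longrightarrow> P x) \<Longrightarrow> AE x in lebesgue. P x"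
  using eventually_ae_filter_negligible by blast

lemma locally_integrable_imp_integrable_on:
  "locally_integrable f \<Longrightarrow> f integrable_on cbox a b"
  by (simp add: locally_integrable_def set_lebesgue_integral_eq_integral(1))

text \<open>Lebesgue differentiation: at almost every point the value of \<open>h\<close> is the
  limit of its averages over small intervals starting there, and all these averages vanish.\<close>

lemma AE_zero_if_integrals_zero:
  assumes "locally_integrable h" and zero: "\<And>a b. a < b \<Longrightarrow> integral {a..b} h = 0"
  shows "AE x in lebesgue. h x = 0"
proof -
  obtain N where N: "negligible N" "\<And>x e. \<lbrakk>x \<notin> N; 0 < e\<rbrakk> \<Longrightarrow> \<exists>d>0. \<forall>r. 0 < r \<and> r < d \<longrightarrow>
      norm (integral (cbox x (x + r *\<^sub>R One)) h /\<^sub>R r ^ DIM(real) - h x) < e"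
    using integrable_ccontinuous_explicit[of h] locally_integrable_imp_integrable_on[OF assms(1)]
    by metis
  have "h x = 0" if x: "x \<notin> N" for x
  proof (rule ccontr)
    assume "h x \<noteq> 0"
    then obtain d where "d > 0" and d: "\<forall>r. 0 < r \<and> r < d \<longrightarrow>
      norm (integral (cbox x (x + r *\<^sub>R One)) h /\<^sub>R r ^ DIM(real) - h x) < \<bar>h x\<bar>"
      using N(2)[OF x, of "\<bar>h x\<bar>"] by auto
    from \<open>d > 0\<close> have "0 < d / 2 \<and> d / 2 < d" by simp
    then have "norm (integral (cbox x (x + (d / 2) *\<^sub>R One)) h /\<^sub>R (d / 2) ^ DIM(real) - h x) < \<bar>h x\<bar>"
      using d by blast
    then show False
      using zero[of x "x + d / 2"] \<open>d > 0\<close> by simp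
  qed
  then show ?thesis using N(1) by (rule AE_lebesgueI[rotated])
qed

text \<open>The bumps increase the supply of tests up to indicators of intervals: dominated
  convergence passes from \<open>bump a b k\<close> to the indicator, which reduces the claim to
  vanishing integrals over intervals.\<close>

lemma fundamental_lemma_variations:
  assumes h: "locally_integrable h"
    and zero: "\<And>\<phi>. \<phi> \<in> test_functions \<Longrightarrow> (LINT x|lebesgue. h x * \<phi> x) = 0"
  shows "AE x in lebesgue. h x = 0"
proof (rule AE_zero_if_integrals_zero[OF h])
  fix a b :: real assume "a < b"
  have int: "integrable lebesgue (\<lambda>x. indicator {a..b} x *\<^sub>R h x)"
    using h by (simp add: locally_integrable_def set_integrable_def)
  have "(\<lambda>k. LINT x|lebesgue. h x * bump a b k x) \<longlonglongrightarrow> (LINT x|lebesgue. h x * indicator {a<..<b} x)"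
  proof (rule integral_dominated_convergence)
    show "integrable lebesgue (\<lambda>x. norm (indicator {a..b} x *\<^sub>R h x))"
      using int by (rule integrable_norm)
    \<comment> \<open>Local integrability provides measurability only for \<open>h\<close> cut off
      to a compact set, so the cut-off is inserted before measurability is discussed.\<close>
    have eq: "h x * bump a b k x = (indicator {a..b} x *\<^sub>R h x) * bump a b k x" for k x
      using bump_outside[of x a b k] by (cases "x \<in> {a..b}") auto
    show "(\<lambda>x. h x * bump a b k x) \<in> borel_measurable lebesgue" for k
      unfolding eq
      by (intro borel_measurable_times borel_measurable_integrable[OF int]
          continuous_measurable_lebesgue smooth_imp_continuous test_functions_smooth bump_test)
    have eq': "h x * indicator {a<..<b} x = (indicator {a..b} x *\<^sub>R h x) * indicator {a<..<b} x" for x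
      by (auto simp: indicator_def)
    show "(\<lambda>x. h x * indicator {a<..<b} x) \<in> borel_measurable lebesgue"
      unfolding eq' using int
      by (intro borel_measurable_times borel_measurable_integrable borel_measurable_indicator) auto
    show "AE x in lebesgue. (\<lambda>k. h x * bump a b k x) \<longlonglongrightarrow> h x * indicator {a<..<b} x"
      by (intro AE_I2 tendsto_intros bump_tendsto_indicator)
    show "AE x in lebesgue. norm (h x * bump a b k x) \<le> norm (indicator {a..b} x *\<^sub>R h x)" for k
    proof (intro AE_I2)
      fix x
      have "\<bar>h x\<bar> * bump a b k x \<le> \<bar>h x\<bar> * 1"
        by (intro mult_left_mono bump_bounds) auto
      then show "norm (h x * bump a b k x) \<le> norm (indicator {a..b} x *\<^sub>R h x)"
        using bump_outside[of x a b k] bump_bounds[of a b k x]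
        by (cases "x \<in> {a..b}") (auto simp: abs_mult)
    qed
  qed
  moreover have "(LINT x|lebesgue. h x * bump a b k x) = 0" for k
    by (intro zero bump_test)
  ultimately have "(LINT x|lebesgue. h x * indicator {a<..<b} x) = 0"
    by (simp add: LIMSEQ_const_iff)
  moreover have "set_integrable lebesgue {a<..<b} h"
    by (rule set_integrable_subset[of _ "{a..b}"]) (use int in \<open>auto simp: set_integrable_def\<close>)
  ultimately have "integral {a<..<b} h = 0"
    using set_lebesgue_integral_eq_integral(2)[of "{a<..<b}" h]
    by (simp add: set_lebesgue_integral_def mult.commute)
  then show "integral {a..b} h = 0"
    using integral_open_interval_real by metis
qed

lemma test_function_integrable:
  assumes "\<phi> \<in> test_functions"
  shows "integrable lebesgue \<phi>"
proof -
  obtain r where "0 < r" "\<And>x. x \<notin> {-r..r} \<Longrightarrow> \<phi> x = 0"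
    using test_functionsD[OF assms] by blast
  then show ?thesis
    using integrable_mult_compact_support[of "\<lambda>x. 1" \<phi> r] assms
    by (simp add: locally_integrable_continuous smooth_imp_continuous test_functions_smooth)
qed

lemma test_function_integral:
  assumes "\<phi> \<in> test_functions" "\<And>x. x \<notin> {a..b} \<Longrightarrow> \<phi> x = 0"
  shows "integral {a..b} \<phi> = (LINT x|lebesgue. \<phi> x)"
proof -
  have eq: "(\<lambda>x. if x \<in> {a..b} then \<phi> x else 0) = \<phi>"
    using assms(2) by (intro ext) presburger
  have "(\<phi> has_integral (LINT x|lebesgue. \<phi> x)) UNIV"
    by (rule has_integral_integral_lebesgue[OF test_function_integrable[OF assms(1)]])
  then have "(\<phi> has_integral (LINT x|lebesgue. \<phi> x)) {a..b}"
    using has_integral_restrict_UNIV[of "{a..b}" \<phi>] unfolding eq by blast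
  then show ?thesis by (rule integral_unique)
qed

text \<open>A test function is the derivative of a test function as soon as its integral vanishes.
  Subtracting from \<phi> its integral times a fixed test function \<open>\<phi>\<^sub>0\<close> of
  mass 1 achieves this, and it shows that \<open>w - c\<close> annihilates \<phi>, where
  \<open>c\<close> is the integral of \<open>w * \<phi>\<^sub>0\<close>.\<close>

lemma du_Bois_Reymond:
  assumes w: "locally_integrable w"
    and zero: "\<And>\<phi>. \<phi> \<in> test_functions \<Longrightarrow> (LINT x|lebesgue. w x * deriv \<phi> x) = 0"
  shows "\<exists>c. AE x in lebesgue. w x = c"
proof -
  define \<phi>\<^sub>0 where "\<phi>\<^sub>0 = (\<lambda>x. bump (-1) 1 0 x / integral {-1..1} (bump (-1) 1 0))"
  have \<phi>\<^sub>0_test: "\<phi>\<^sub>0 \<in> test_functions"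
  proof (rule test_functionsI)
    show "smooth \<phi>\<^sub>0"
      using smooth_mult[OF test_functions_smooth[OF bump_test] smooth_const]
      unfolding \<phi>\<^sub>0_def divide_inverse by blast
    show "x \<notin> {-1..1} \<Longrightarrow> \<phi>\<^sub>0 x = 0" for x
      by (simp add: \<phi>\<^sub>0_def bump_outside)
  qed
  \<comment> \<open>The normalising constant in \<open>\<phi>\<^sub>0\<close> is positive, so the
    division is genuine.\<close>
  have "integral {-1..1} (\<lambda>x::real. 0::real) < integral {-1..1} (bump (-1) 1 0)"
    by (rule integral_less_real)
       (use bump_pos in \<open>auto intro!: smooth_imp_continuous test_functions_smooth bump_test\<close>)
  then have \<phi>\<^sub>0_int: "(LINT x|lebesgue. \<phi>\<^sub>0 x) = 1"
    using test_function_integral[OF bump_test[of "-1" 1 0] bump_outside] by (simp add: \<phi>\<^sub>0_def)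
  define c where "c = (LINT x|lebesgue. w x * \<phi>\<^sub>0 x)"
  have "AE x in lebesgue. w x - c = 0"
  proof (rule fundamental_lemma_variations)
    show "locally_integrable (\<lambda>x. w x - c)"
      by (intro locally_integrable_diff w locally_integrable_continuous) auto
  next
    fix \<phi> assume \<phi>: "\<phi> \<in> test_functions"
    define s where "s = (LINT x|lebesgue. \<phi> x)"
    define \<psi>' where "\<psi>' = (\<lambda>x. \<phi> x - s * \<phi>\<^sub>0 x)"
    obtain r1 where "0 < r1" and r1: "\<And>x. x \<notin> {-r1..r1} \<Longrightarrow> \<phi> x = 0"
      using test_functionsD[OF \<phi>] by blast
    obtain r2 where "0 < r2" and r2: "\<And>x. x \<notin> {-r2..r2} \<Longrightarrow> \<phi>\<^sub>0 x = 0"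
      using test_functionsD[OF \<phi>\<^sub>0_test] by blast
    define r where "r = max r1 r2"
    have r: "0 < r" "\<And>x. x \<notin> {-r..r} \<Longrightarrow> \<phi> x = 0" "\<And>x. x \<notin> {-r..r} \<Longrightarrow> \<phi>\<^sub>0 x = 0"
      unfolding r_def using \<open>0 < r1\<close> by (auto intro!: r1 r2)
    have \<psi>'_smooth: "smooth \<psi>'"
      unfolding \<psi>'_def using \<phi> \<phi>\<^sub>0_test
      by (intro smooth_diff smooth_mult smooth_const test_functions_smooth)
    have \<psi>'_out: "\<psi>' x = 0" if "x \<notin> {-r..r}" for x
      using r that by (simp add: \<psi>'_def)
    have \<psi>'_cont: "continuous_on A \<psi>'" for A
      by (rule smooth_imp_continuous[OF \<psi>'_smooth])
    have \<psi>'_test: "\<psi>' \<in> test_functions"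
      using \<psi>'_smooth \<psi>'_out by (rule test_functionsI)
    have \<psi>'_int: "(LINT x|lebesgue. \<psi>' x) = 0"
      using \<phi> \<phi>\<^sub>0_test \<phi>\<^sub>0_int by (simp add: \<psi>'_def test_function_integrable s_def)
    \<comment> \<open>Starting one unit to the left of the support makes every
      \<open>x \<ge> -r\<close> an interior point of the interval of integration, so that one-sided
      derivatives at \<open>-r\<close> are avoided.\<close>
    define \<psi> where "\<psi> = (\<lambda>x. integral {-r - 1..x} \<psi>')"
    have \<psi>_left: "\<psi> x = 0" if "x < -r" for x
    proof -
      have "\<psi> x = integral {-r - 1..x} (\<lambda>x. 0)"
        unfolding \<psi>_def using that by (intro integral_cong \<psi>'_out) auto
      then show ?thesis by simp
    qed
    \<comment> \<open>Here the zero mean of \<open>\<psi>'\<close> enters: beyond \<open>r\<close>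
      the integral has exhausted the whole support.\<close>
    have \<psi>_right: "\<psi> x = 0" if "r < x" for x
      unfolding \<psi>_def \<psi>'_int[symmetric] using that
      by (intro test_function_integral \<psi>'_test \<psi>'_out) auto
    have \<psi>_out: "\<psi> x = 0" if "x \<notin> {-r..r}" for x
      using that \<psi>_left \<psi>_right by force
    have \<psi>_deriv: "(\<psi> has_real_derivative \<psi>' x) (at x)" for x
    proof (cases "x < -r")
      case True
      have "((\<lambda>x. 0) has_real_derivative 0) (at x)" by simp
      then have "(\<psi> has_real_derivative 0) (at x)"
        by (rule has_field_derivative_transform_within_open[where S = "{..<-r}"])
           (use True \<psi>_left in auto)
      then show ?thesis using \<psi>'_out[of x] True by simp
    next
      case False
      then have "(\<psi> has_real_derivative \<psi>' x) (at x within {-r - 1..x + 1})"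
        unfolding \<psi>_def by (intro integral_has_real_derivative \<psi>'_cont) auto
      then show ?thesis
        using False by (simp add: at_within_Icc_at)
    qed
    have "\<psi> \<in> test_functions"
      by (rule test_functionsI[OF smooth_antiderivative[OF \<psi>_deriv \<psi>'_smooth] \<psi>_out])
    from zero[OF this] have "(LINT x|lebesgue. w x * \<psi>' x) = 0"
      using DERIV_imp_deriv[OF \<psi>_deriv] by simp
    moreover have int: "integrable lebesgue (\<lambda>x. w x * \<phi> x)" "integrable lebesgue (\<lambda>x. w x * \<phi>\<^sub>0 x)"
      using r \<phi> \<phi>\<^sub>0_test
      by (auto intro!: integrable_mult_compact_support[OF w, of _ r] smooth_imp_continuous test_functions_smooth)
    moreover have "w x * \<psi>' x = w x * \<phi> x - s * (w x * \<phi>\<^sub>0 x)" for x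
      by (simp add: \<psi>'_def algebra_simps)
    ultimately have "(LINT x|lebesgue. w x * \<phi> x) = s * c"
      by (simp add: c_def)
    moreover have "(LINT x|lebesgue. (w x - c) * \<phi> x) = (LINT x|lebesgue. w x * \<phi> x) - c * s"
      using int(1) test_function_integrable[OF \<phi>] by (simp add: left_diff_distrib s_def)
    ultimately show "(LINT x|lebesgue. (w x - c) * \<phi> x) = 0"
      by simp
  qed
  then show ?thesis
    by (intro exI[of _ c]) simp
qed

section \<open>Lipschitz functions and weak derivatives\<close>

lemma lipschitz_real_bound:
  fixes f :: "real \<Rightarrow> real"
  assumes "C-lipschitz_on UNIV f"
  shows "\<bar>f x - f y\<bar> \<le> C * \<bar>x - y\<bar>"
  using lipschitz_onD[OF assms, of x y] by (simp add: dist_real_def)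

text \<open>The sum of the two Stieltjes measures gives each bounded open interval its length, so
  uniqueness of Lebesgue measure identifies it with \<open>lborel\<close>, and each summand is
  dominated by it. This replaces an epsilon-delta argument for absolute continuity of
  \<open>F\<close>.\<close>

lemma interval_measure_le_lborel:
  fixes F G :: "real \<Rightarrow> real"
  assumes F: "mono F" "continuous_on UNIV F" and G: "mono G" "continuous_on UNIV G"
    and sum: "\<And>x. F x + G x = x" and "A \<in> sets borel"
  shows "emeasure (interval_measure F) A \<le> emeasure lborel A"
proof -
  define M where "M = measure_of UNIV (sets borel)
    (\<lambda>A. emeasure (interval_measure F) A + emeasure (interval_measure G) A)"
  have sets_M: "sets M = sets borel"
    unfolding M_def by (metis sets.sets_measure_of_eq space_borel)
  have em: "emeasure M A = emeasure (interval_measure F) A + emeasure (interval_measure G) A"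
    if "A \<in> sets borel" for A
  proof (rule emeasure_measure_of[OF M_def])
    show "countably_additive (sets M)
        (\<lambda>A. emeasure (interval_measure F) A + emeasure (interval_measure G) A)"
      unfolding countably_additive_def sets_M
    proof (intro allI impI)
      fix A :: "nat \<Rightarrow> real set" assume A: "range A \<subseteq> sets borel" "disjoint_family A"
      show "(\<Sum>i. emeasure (interval_measure F) (A i) + emeasure (interval_measure G) (A i)) =
          emeasure (interval_measure F) (\<Union> (range A)) + emeasure (interval_measure G) (\<Union> (range A))"
        using A by (subst suminf_add[symmetric]) (auto simp: suminf_emeasure)
    qed
  qed (use that in \<open>auto simp: positive_def sets_M dest: sets.sets_into_space\<close>)
  have Ioo: "emeasure (interval_measure H) {l<..<u} = H u - H l"
    if H: "mono H" "continuous_on UNIV H" and "l \<le> u" for H :: "real \<Rightarrow> real" and l u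
  proof -
    have Icc: "emeasure (interval_measure H) {a..b} = H b - H a" if "a \<le> b" for a b
      using that H by (intro emeasure_interval_measure_Icc) (auto dest: monoD)
    have null: "{a} \<in> null_sets (interval_measure H)" for a
      using Icc[of a a] by (auto simp: null_sets_def)
    have "emeasure (interval_measure H) ({l..u} - {l} - {u}) = H u - H l"
      using Icc[OF \<open>l \<le> u\<close>] by (simp add: emeasure_Diff_null_set null)
    moreover have "{l..u} - {l} - {u} = {l<..<u}" by auto
    ultimately show ?thesis by simp
  qed
  have "lborel = M"
  proof (rule lborel_eqI)
    fix l u :: real assume "\<And>b. b \<in> Basis \<Longrightarrow> l \<bullet> b \<le> u \<bullet> b"
    then have "l \<le> u" by simp
    have "emeasure M (box l u) = ennreal (F u - F l) + ennreal (G u - G l)"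
      using F G \<open>l \<le> u\<close> by (subst em) (auto simp: Ioo)
    also have "\<dots> = ennreal (F u - F l + (G u - G l))"
      using F G \<open>l \<le> u\<close> by (simp add: monoD)
    also have "F u - F l + (G u - G l) = (\<Prod>b\<in>Basis. (u - l) \<bullet> b)"
      using sum[of u] sum[of l] by (simp add: algebra_simps)
    finally show "emeasure M (box l u) = (\<Prod>b\<in>Basis. (u - l) \<bullet> b)" .
  qed (rule sets_M)
  then show ?thesis
    using em[OF \<open>A \<in> sets borel\<close>] by simp
qed

text \<open>This is the absolute continuity of Lipschitz functions. The Radon-Nikodym density
  supplies an integrand before any differentiability of \<open>f\<close> is known.\<close>

lemma lipschitz_density:
  fixes f :: "real \<Rightarrow> real"
  assumes f: "C-lipschitz_on UNIV f"
  obtains g where "g \<in> borel_measurable borel"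
    "\<And>a b. a \<le> b \<Longrightarrow> (g has_integral f b - f a) {a..b}"
proof -
  \<comment> \<open>The shift by 1 keeps the divisor \<open>L\<close> positive even for a constant
    \<open>f\<close> with \<open>C = 0\<close>.\<close>
  define L where "L = C + 1"
  have "0 < L" using lipschitz_on_nonneg[OF f] by (simp add: L_def)
  have bound: "\<bar>f y - f x\<bar> \<le> L * (y - x)" if "x \<le> y" for x y
  proof -
    have "\<bar>f y - f x\<bar> \<le> C * (y - x)"
      using lipschitz_real_bound[OF f, of y x] that by simp
    then show ?thesis using that by (simp add: L_def algebra_simps)
  qed
  define F G where "F = (\<lambda>x. (x + f x / L) / 2)" and "G = (\<lambda>x. (x - f x / L) / 2)"
  have mono: "mono F" "mono G"
  proof -
    have "F x \<le> F y \<and> G x \<le> G y" if "x \<le> y" for x y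
    proof -
      have "\<bar>f y / L - f x / L\<bar> \<le> y - x"
        using bound[OF that] \<open>0 < L\<close>
        by (simp add: diff_divide_distrib[symmetric] divide_le_eq mult.commute)
      then have "x + f x / L \<le> y + f y / L" "x - f x / L \<le> y - f y / L"
        unfolding abs_le_iff by linarith+
      then show ?thesis
        unfolding F_def G_def by (intro conjI divide_right_mono) auto
    qed
    then show "mono F" "mono G" by (auto intro: monoI)
  qed
  have cont: "continuous_on UNIV F" "continuous_on UNIV G"
    using \<open>0 < L\<close> unfolding F_def G_def
    by (intro continuous_intros lipschitz_on_continuous_on[OF f]; simp)+
  define \<mu> where "\<mu> = interval_measure F"
  have le: "emeasure \<mu> A \<le> emeasure lborel A" if "A \<in> sets borel" for A
    unfolding \<mu>_def
    by (rule interval_measure_le_lborel[OF mono(1) cont(1) mono(2) cont(2) _ that])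
       (simp add: F_def G_def field_simps)
  have sets_\<mu>: "sets \<mu> = sets lborel" by (simp add: \<mu>_def)
  have ac: "absolutely_continuous lborel \<mu>"
    unfolding absolutely_continuous_def null_sets_def using le sets_\<mu> by fastforce
  define h where "h = RN_deriv lborel \<mu>"
  have [measurable]: "h \<in> borel_measurable borel"
    using borel_measurable_RN_deriv[of lborel \<mu>] by (simp add: h_def)
  have density: "density lborel h = \<mu>"
    unfolding h_def by (rule sigma_finite_measure.density_RN_deriv[OF sigma_finite_lborel ac sets_\<mu>])
  have "sigma_finite_measure \<mu>"
    unfolding \<mu>_def using mono(1) cont(1)
    by (intro sigma_finite_interval_measure)
       (auto dest: monoD intro: continuous_within_subset simp: continuous_on_eq_continuous_within)
  \<comment> \<open>The density takes values in \<open>[0, \<infinity>]\<close>; it may be replaced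
    by \<open>enn2real (h x)\<close> under the integral because the value infinity occurs only on a
    null set.\<close>
  then have finite: "AE x in lborel. h x \<noteq> \<infinity>"
    unfolding h_def by (intro sigma_finite_measure.RN_deriv_finite[OF sigma_finite_lborel] ac sets_\<mu>)
  have int_h: "((\<lambda>x. enn2real (h x)) has_integral F b - F a) {a..b}" if "a \<le> b" for a b
  proof -
    have "(\<integral>\<^sup>+x. ennreal (enn2real (h x) * indicator {a..b} x) \<partial>lborel) =
        (\<integral>\<^sup>+x. h x * indicator {a..b} x \<partial>lborel)"
    proof (rule nn_integral_cong_AE)
      show "AE x in lborel. ennreal (enn2real (h x) * indicator {a..b} x) = h x * indicator {a..b} x"
        using finite by eventually_elim (auto simp: indicator_def less_top[symmetric])
    qed
    also have "\<dots> = emeasure \<mu> {a..b}"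
      unfolding density[symmetric] by (simp add: emeasure_density)
    also have "\<dots> = ennreal (F b - F a)"
      unfolding \<mu>_def using mono(1) cont(1) that
      by (intro emeasure_interval_measure_Icc) (auto dest: monoD)
    finally have "((\<lambda>x. enn2real (h x) * indicator {a..b} x) has_integral F b - F a) UNIV"
      using mono(1) that by (intro nn_integral_has_integral) (auto dest: monoD)
    moreover have "(\<lambda>x. enn2real (h x) * indicator {a..b} x) =
        (\<lambda>x. if x \<in> {a..b} then enn2real (h x) else 0)"
      by (auto simp: indicator_def)
    ultimately show ?thesis
      using has_integral_restrict_UNIV[of "{a..b}" "\<lambda>x. enn2real (h x)"] by simp
  qed
  \<comment> \<open>Solving \<open>2 * F x = x + f x / L\<close> for \<open>f\<close> gives
    \<open>f x = L * (2 * F x - x)\<close>; \<open>g\<close> is its formal derivative.\<close>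
  define g where "g = (\<lambda>x. L * (2 * enn2real (h x) - 1))"
  show thesis
  proof (rule that)
    show "g \<in> borel_measurable borel" unfolding g_def by measurable
    show "(g has_integral f b - f a) {a..b}" if "a \<le> b" for a b
    proof -
      have "((\<lambda>x. L * (2 * enn2real (h x) - 1)) has_integral L * (2 * (F b - F a) - (b - a))) {a..b}"
        using that has_integral_const_real[of "1::real" a b]
        by (intro has_integral_mult_right has_integral_diff int_h) auto
      moreover have "L * (2 * (F b - F a) - (b - a)) = f b - f a"
        using \<open>0 < L\<close> by (simp add: F_def field_simps)
      ultimately show ?thesis by (simp add: g_def)
    qed
  qed
qed

section \<open>Differentiation of indefinite integrals\<close>

lemma right_derivative_of_integral:
  fixes f g :: "real \<Rightarrow> real"
  assumes int: "\<And>a b. a \<le> b \<Longrightarrow> (g has_integral f b - f a) {a..b}"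
  obtains N where "negligible N"
    "\<And>x e. x \<notin> N \<Longrightarrow> 0 < e \<Longrightarrow> \<exists>d>0. \<forall>h. 0 < h \<and> h < d \<longrightarrow> \<bar>(f (x + h) - f x) / h - g x\<bar> < e"
proof -
  have on: "g integrable_on cbox a b" for a b
  proof (cases "a \<le> b")
    case True
    then show ?thesis using int[of a b] by (auto simp: integrable_on_def)
  qed (simp add: integrable_on_empty)
  obtain N where N: "negligible N"
    "\<And>x e. \<lbrakk>x \<notin> N; 0 < e\<rbrakk> \<Longrightarrow> \<exists>d>0. \<forall>h. 0 < h \<and> h < d \<longrightarrow>
      norm (integral (cbox x (x + h *\<^sub>R One)) g /\<^sub>R h ^ DIM(real) - g x) < e"
    using integrable_ccontinuous_explicit[of g, OF on] by blast
  have eq: "norm (integral (cbox x (x + h *\<^sub>R One)) g /\<^sub>R h ^ DIM(real) - g x) =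
      \<bar>(f (x + h) - f x) / h - g x\<bar>" if "0 < h" for x h
    using integral_unique[OF int[of x "x + h"]] that by (simp add: divide_inverse mult.commute)
  show thesis
  proof (rule that[OF N(1)])
    fix x e :: real assume "x \<notin> N" "0 < e"
    then obtain d where "d > 0" "\<forall>h. 0 < h \<and> h < d \<longrightarrow>
      norm (integral (cbox x (x + h *\<^sub>R One)) g /\<^sub>R h ^ DIM(real) - g x) < e"
      using N(2) by blast
    then show "\<exists>d>0. \<forall>h. 0 < h \<and> h < d \<longrightarrow> \<bar>(f (x + h) - f x) / h - g x\<bar> < e"
      using eq by (intro exI[of _ d]) metis
  qed
qed

text \<open>Averages over intervals that start at \<open>x\<close> yield only the right derivative.
  The left derivative is a right derivative after the reflection of the line at 0, at the cost of a
  second, reflected null set.\<close>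

lemma AE_derivative_of_integral:
  fixes f g :: "real \<Rightarrow> real"
  assumes int: "\<And>a b. a \<le> b \<Longrightarrow> (g has_integral f b - f a) {a..b}"
  shows "AE x in lebesgue. (f has_real_derivative g x) (at x)"
proof -
  obtain N1 where N1: "negligible N1"
    "\<And>x e. x \<notin> N1 \<Longrightarrow> 0 < e \<Longrightarrow> \<exists>d>0. \<forall>h. 0 < h \<and> h < d \<longrightarrow> \<bar>(f (x + h) - f x) / h - g x\<bar> < e"
    using right_derivative_of_integral[of g f, OF int] by blast
  \<comment> \<open>The reflected integrand has the antiderivative
    \<open>\<lambda>x. - f (- x)\<close>; the outer sign comes from reversing the
    orientation.\<close>
  have "((\<lambda>x. g (- x)) has_integral - f (- b) - (- f (- a))) {a..b}" if "a \<le> b" for a b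
    using int[of "-b" "-a"] that has_integral_reflect_real[of g "f (- a) - f (- b)" "-a" "-b"] by simp
  then obtain N2 where N2: "negligible N2"
    "\<And>x e. x \<notin> N2 \<Longrightarrow> 0 < e \<Longrightarrow>
      \<exists>d>0. \<forall>h. 0 < h \<and> h < d \<longrightarrow> \<bar>(- f (- (x + h)) - (- f (- x))) / h - g (- x)\<bar> < e"
    using right_derivative_of_integral[of "\<lambda>x. g (- x)" "\<lambda>x. - f (- x)"] by blast
  have "negligible (uminus ` N2)"
    using N2(1) by (intro negligible_differentiable_image_negligible differentiable_on_minus
        differentiable_on_ident) auto
  with N1(1) have "negligible (N1 \<union> uminus ` N2)" by (rule negligible_Un)
  then show ?thesis
  proof (rule AE_lebesgueI)
    fix x assume x: "x \<notin> N1 \<union> uminus ` N2"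
    then have x2: "- x \<notin> N2" by (metis UnI2 image_eqI minus_minus)
    show "(f has_real_derivative g x) (at x)"
      unfolding DERIV_def LIM_eq
    proof (intro allI impI)
      fix e :: real assume "0 < e"
      obtain d1 where "d1 > 0" and d1: "\<And>h. 0 < h \<Longrightarrow> h < d1 \<Longrightarrow> \<bar>(f (x + h) - f x) / h - g x\<bar> < e"
        using N1(2)[of x e] x \<open>0 < e\<close> by blast
      obtain d2 where "d2 > 0" and
        d2: "\<And>h. 0 < h \<Longrightarrow> h < d2 \<Longrightarrow> \<bar>(- f (- (- x + h)) - (- f (- (- x)))) / h - g (- (- x))\<bar> < e"
        using N2(2)[OF x2 \<open>0 < e\<close>] by blast
      have "\<bar>(f (x + h) - f x) / h - g x\<bar> < e" if "h \<noteq> 0" "\<bar>h\<bar> < min d1 d2" for h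
      proof (cases "0 < h")
        case True
        then show ?thesis using d1 that by simp
      next
        case False
        then have "\<bar>(- f (- (- x + - h)) - (- f (- (- x)))) / (- h) - g (- (- x))\<bar> < e"
          using that by (intro d2) auto
        moreover have "(- f (- (- x + - h)) - (- f (- (- x)))) / (- h) = (f (x + h) - f x) / h"
          using that(1) by (simp add: field_simps)
        ultimately show ?thesis by simp
      qed
      then show "\<exists>s>0. \<forall>h. h \<noteq> 0 \<and> norm (h - 0) < s \<longrightarrow> norm ((f (x + h) - f x) / h - g x) < e"
        using \<open>d1 > 0\<close> \<open>d2 > 0\<close> by (intro exI[of _ "min d1 d2"]) auto
    qed
  qed
qed

lemma lipschitz_derivative_bound:
  fixes f :: "real \<Rightarrow> real"
  assumes f: "C-lipschitz_on UNIV f" and D: "(f has_real_derivative D) (at x)"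
  shows "\<bar>D\<bar> \<le> C"
proof (rule tendsto_upperbound)
  show "((\<lambda>h. \<bar>(f (x + h) - f x) / h\<bar>) \<longlongrightarrow> \<bar>D\<bar>) (at 0)"
    using D unfolding DERIV_def by (rule tendsto_rabs)
  have "\<bar>(f (x + h) - f x) / h\<bar> \<le> C" if "h \<noteq> 0" for h
    using lipschitz_real_bound[OF f, of "x + h" x] that by (simp add: divide_le_eq)
  then show "\<forall>\<^sub>F h in at 0. \<bar>(f (x + h) - f x) / h\<bar> \<le> C"
    by (simp add: eventually_at_filter)
qed simp

text \<open>Truncating the density at \<open>C\<close> in absolute value makes the bound hold at
  every point. It changes nothing off the null set, since a derivative of a
  \<open>C\<close>-Lipschitz function never exceeds \<open>C\<close> in absolute value.\<close>

lemma lipschitz_AE_derivative: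
  fixes f :: "real \<Rightarrow> real"
  assumes f: "C-lipschitz_on UNIV f"
  obtains g where "g \<in> borel_measurable lebesgue" "\<And>x. \<bar>g x\<bar> \<le> C"
    "\<And>a b. a \<le> b \<Longrightarrow> (g has_integral f b - f a) {a..b}"
    "AE x in lebesgue. (f has_real_derivative g x) (at x)"
proof -
  obtain h where h: "h \<in> borel_measurable borel"
    "\<And>a b. a \<le> b \<Longrightarrow> (h has_integral f b - f a) {a..b}"
    using lipschitz_density[OF f] by blast
  obtain N where N: "negligible N" "\<And>x. x \<notin> N \<Longrightarrow> (f has_real_derivative h x) (at x)"
    using AE_derivative_of_integral[of h f, OF h(2)] unfolding eventually_ae_filter_negligible by blast
  define g where "g = (\<lambda>x. max (- C) (min C (h x)))"
  have eq: "g x = h x" if "x \<notin> N" for x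
    using lipschitz_derivative_bound[OF f N(2)[OF that]] by (auto simp: g_def)
  show thesis
  proof (rule that)
    have "h \<in> borel_measurable lebesgue"
      using h(1) by (intro measurable_completion) simp
    then show "g \<in> borel_measurable lebesgue"
      unfolding g_def by (intro borel_measurable_max borel_measurable_min) auto
    show "\<bar>g x\<bar> \<le> C" for x
      using lipschitz_on_nonneg[OF f] by (auto simp: g_def)
    show "(g has_integral f b - f a) {a..b}" if "a \<le> b" for a b
      by (rule has_integral_spike[OF N(1) _ h(2)[OF that]]) (simp add: eq)
    show "AE x in lebesgue. (f has_real_derivative g x) (at x)"
      by (rule AE_lebesgueI[OF N(1)]) (simp add: N(2) eq)
  qed
qed

section \<open>Integration by parts against test functions\<close>

lemma deriv_test_function_outside:
  assumes "\<And>x. x \<notin> {-r..r} \<Longrightarrow> \<phi> x = 0" and "x \<notin> {-r..r}"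
  shows "deriv \<phi> x = (0::real)"
proof -
  have "((\<lambda>x. 0) has_real_derivative 0) (at x)" by simp
  then have "(\<phi> has_real_derivative 0) (at x)"
    by (rule has_field_derivative_transform_within_open[where S = "- {-r..r}"])
       (use assms in \<open>auto simp: open_Compl\<close>)
  then show ?thesis by (rule DERIV_imp_deriv)
qed

lemma test_function_lipschitz:
  assumes "\<phi> \<in> test_functions"
  obtains L where "L-lipschitz_on UNIV \<phi>"
proof -
  obtain r where r: "0 < r" "\<And>x. x \<notin> {-r..r} \<Longrightarrow> \<phi> x = 0"
    using test_functionsD[OF assms] by blast
  have smooth: "smooth \<phi>" using assms by (rule test_functions_smooth)
  have "bounded (deriv \<phi> ` {-r..r})"
    by (intro compact_imp_bounded compact_continuous_image smooth_imp_continuous smooth_deriv smooth) auto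
  then obtain B where "0 < B" and B: "\<And>x. x \<in> {-r..r} \<Longrightarrow> \<bar>deriv \<phi> x\<bar> \<le> B"
    unfolding bounded_pos by auto
  have "\<bar>deriv \<phi> x\<bar> \<le> B" for x
    using B[of x] deriv_test_function_outside[of r \<phi> x, OF r(2)] \<open>0 < B\<close> by (cases "x \<in> {-r..r}") auto
  then have "norm (\<phi> x - \<phi> y) \<le> B * norm (x - y)" for x y
    by (intro field_differentiable_bound[of UNIV \<phi> "deriv \<phi>"])
       (auto intro: smooth_has_derivative[OF smooth])
  then have "B-lipschitz_on UNIV \<phi>"
    using \<open>0 < B\<close> by (intro lipschitz_onI) (auto simp: dist_real_def)
  then show thesis by (rule that)
qed

lemma lipschitz_mult_compact_support:
  fixes f \<phi> :: "real \<Rightarrow> real"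
  assumes f: "C-lipschitz_on UNIV f" and \<phi>: "L-lipschitz_on UNIV \<phi>"
    and supp: "\<And>x. x \<notin> {-r..r} \<Longrightarrow> \<phi> x = 0"
  obtains K where "K-lipschitz_on UNIV (\<lambda>x. f x * \<phi> x)"
proof -
  have "bounded (f ` {-r..r})"
    by (intro compact_imp_bounded compact_continuous_image
        continuous_on_subset[OF lipschitz_on_continuous_on[OF f]]) auto
  then obtain A where "0 < A" and A: "\<And>x. x \<in> {-r..r} \<Longrightarrow> \<bar>f x\<bar> \<le> A"
    unfolding bounded_pos by auto
  have "bounded (\<phi> ` {-r..r})"
    by (intro compact_imp_bounded compact_continuous_image
        continuous_on_subset[OF lipschitz_on_continuous_on[OF \<phi>]]) auto
  then obtain B where "0 < B" and B': "\<And>x. x \<in> {-r..r} \<Longrightarrow> \<bar>\<phi> x\<bar> \<le> B"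
    unfolding bounded_pos by auto
  have B: "\<bar>\<phi> x\<bar> \<le> B" for x
    using B'[of x] supp[of x] \<open>0 < B\<close> by (cases "x \<in> {-r..r}") auto
  define K where "K = A * L + C * B"
  have "0 \<le> K"
    using lipschitz_on_nonneg[OF f] lipschitz_on_nonneg[OF \<phi>] \<open>0 < A\<close> \<open>0 < B\<close> by (simp add: K_def)
  have inside: "\<bar>f x * \<phi> x - f y * \<phi> y\<bar> \<le> K * \<bar>x - y\<bar>" if "x \<in> {-r..r}" for x y
  proof -
    \<comment> \<open>The splitting evaluates the bare factor \<open>f\<close> only at the point
      \<open>x\<close> of the support interval, where it is bounded; \<open>y\<close> is arbitrary,
      and there only the globally bounded \<phi> is left alone.\<close>
    have "f x * \<phi> x - f y * \<phi> y = f x * (\<phi> x - \<phi> y) + (f x - f y) * \<phi> y"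
      by (simp add: algebra_simps)
    then have "\<bar>f x * \<phi> x - f y * \<phi> y\<bar> \<le> \<bar>f x\<bar> * \<bar>\<phi> x - \<phi> y\<bar> + \<bar>f x - f y\<bar> * \<bar>\<phi> y\<bar>"
      by (metis abs_mult abs_triangle_ineq)
    also have "\<dots> \<le> A * (L * \<bar>x - y\<bar>) + (C * \<bar>x - y\<bar>) * B"
      using lipschitz_real_bound[OF f, of x y] lipschitz_real_bound[OF \<phi>, of x y] A[OF that] B[of y]
        \<open>0 < A\<close> lipschitz_on_nonneg[OF f]
      by (intro add_mono mult_mono) auto
    finally show ?thesis by (simp add: K_def algebra_simps)
  qed
  have "\<bar>f x * \<phi> x - f y * \<phi> y\<bar> \<le> K * \<bar>x - y\<bar>" for x y
  proof -
    consider "x \<in> {-r..r}" | "y \<in> {-r..r}" | "x \<notin> {-r..r}" "y \<notin> {-r..r}" by blast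
    then show ?thesis
    proof cases
      case 1
      then show ?thesis by (rule inside)
    next
      case 2
      then show ?thesis using inside[of y x] by (simp add: abs_minus_commute)
    next
      case 3
      then show ?thesis using supp[of x] supp[of y] \<open>0 \<le> K\<close> by simp
    qed
  qed
  then have "K-lipschitz_on UNIV (\<lambda>x. f x * \<phi> x)"
    using \<open>0 \<le> K\<close> by (intro lipschitz_onI) (auto simp: dist_real_def)
  then show thesis by (rule that)
qed

lemma has_weak_derivative_alt:
  "has_weak_derivative u g \<longleftrightarrow> locally_integrable u \<and> locally_integrable g \<and>
    (\<forall>\<phi>\<in>test_functions. (LINT x|lebesgue. u x * deriv \<phi> x) = - (LINT x|lebesgue. g x * \<phi> x))"
  by (auto simp: has_weak_derivative_def locally_integrable_def)

text \<open>The product \<open>f x * \<phi> x\<close> is Lipschitz, so it is the integral of its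
  almost everywhere derivative, which is \<open>p\<close> by the product rule. Its boundary values
  vanish, hence so does the integral of \<open>p\<close>.\<close>

lemma lipschitz_has_weak_derivative:
  assumes f: "C-lipschitz_on UNIV f" and g: "locally_integrable g"
    and AE: "AE x in lebesgue. (f has_real_derivative g x) (at x)"
  shows "has_weak_derivative f g"
  unfolding has_weak_derivative_alt
proof (intro conjI ballI)
  show f_int: "locally_integrable f"
    by (intro locally_integrable_continuous lipschitz_on_continuous_on[OF f])
  fix \<phi> assume \<phi>: "\<phi> \<in> test_functions"
  obtain r where r: "0 < r" "\<And>x. x \<notin> {-r..r} \<Longrightarrow> \<phi> x = 0"
    using test_functionsD[OF \<phi>] by blast
  obtain L where L: "L-lipschitz_on UNIV \<phi>" using test_function_lipschitz[OF \<phi>] .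
  obtain K where K: "K-lipschitz_on UNIV (\<lambda>x. f x * \<phi> x)"
    using lipschitz_mult_compact_support[OF f L r(2)] by blast
  obtain k where k: "\<And>a b. a \<le> b \<Longrightarrow> (k has_integral f b * \<phi> b - f a * \<phi> a) {a..b}"
    "AE x in lebesgue. ((\<lambda>x. f x * \<phi> x) has_real_derivative k x) (at x)"
    by (rule lipschitz_AE_derivative[OF K], rule that)
  have smooth: "smooth \<phi>" using \<phi> by (rule test_functions_smooth)
  define p where "p = (\<lambda>x. f x * deriv \<phi> x + g x * \<phi> x)"
  have int: "integrable lebesgue (\<lambda>x. f x * deriv \<phi> x)" "integrable lebesgue (\<lambda>x. g x * \<phi> x)"
    by (auto intro!: integrable_mult_compact_support[where r = r] f_int g smooth_imp_continuous
        smooth_deriv smooth r(2) deriv_test_function_outside)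
  have p_int: "(p has_integral (LINT x|lebesgue. p x)) UNIV"
    unfolding p_def using int by (intro has_integral_integral_lebesgue) simp
  have p_eq: "AE x in lebesgue. p x = k x"
    using AE k(2)
  proof eventually_elim
    case (elim x)
    have "((\<lambda>x. f x * \<phi> x) has_real_derivative p x) (at x)"
      unfolding p_def using elim(1) smooth_has_derivative[OF smooth, of x]
      by (auto intro!: derivative_eq_intros)
    then show ?case using elim(2) by (rule DERIV_unique)
  qed
  then obtain N where N: "negligible N" "{x. p x \<noteq> k x} \<subseteq> N"
    unfolding eventually_ae_filter_negligible by blast
  \<comment> \<open>The interval is widened by 1 so that its endpoints lie outside
    \<open>{-r..r}\<close>, where \<phi> is known to vanish.\<close>
  have "(\<lambda>x. if x \<in> {-r - 1..r + 1} then p x else 0) = p"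
    using r deriv_test_function_outside[of r \<phi>, OF r(2)] by (auto simp: p_def fun_eq_iff)
  then have "(p has_integral (LINT x|lebesgue. p x)) {-r - 1..r + 1}"
    using p_int has_integral_restrict_UNIV[of "{-r - 1..r + 1}" p] by simp
  moreover have "(k has_integral 0) {-r - 1..r + 1}"
    using k(1)[of "-r - 1" "r + 1"] r by simp
  then have "(p has_integral 0) {-r - 1..r + 1}"
    by (rule has_integral_spike[OF N(1), rotated]) (use N(2) in auto)
  ultimately have "(LINT x|lebesgue. p x) = 0"
    by (rule has_integral_unique)
  then show "(LINT x|lebesgue. f x * deriv \<phi> x) = - (LINT x|lebesgue. g x * \<phi> x)"
    using int by (simp add: p_def)
qed (rule g)

text \<open>The difference of two weak derivatives annihilates every test function. The uniqueness
  lets a statement about the pointwise derivative be carried over to every other version.\<close>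

lemma weak_derivative_unique:
  assumes g: "has_weak_derivative u g" and h: "has_weak_derivative u h"
  shows "AE x in lebesgue. g x = h x"
proof -
  have li: "locally_integrable g" "locally_integrable h"
    using assms by (auto simp: has_weak_derivative_alt)
  have "AE x in lebesgue. g x - h x = 0"
  proof (rule fundamental_lemma_variations)
    show "locally_integrable (\<lambda>x. g x - h x)"
      using li by (rule locally_integrable_diff)
    fix \<phi> assume \<phi>: "\<phi> \<in> test_functions"
    obtain r where r: "0 < r" "\<And>x. x \<notin> {-r..r} \<Longrightarrow> \<phi> x = 0"
      using test_functionsD[OF \<phi>] by blast
    have "integrable lebesgue (\<lambda>x. g x * \<phi> x)" "integrable lebesgue (\<lambda>x. h x * \<phi> x)"
      using li r \<phi> by (auto intro!: integrable_mult_compact_support[where r = r] smooth_imp_continuous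
          test_functions_smooth)
    moreover have "(LINT x|lebesgue. g x * \<phi> x) = (LINT x|lebesgue. h x * \<phi> x)"
    proof -
      have "- (LINT x|lebesgue. g x * \<phi> x) = (LINT x|lebesgue. u x * deriv \<phi> x)"
        using g \<phi> by (simp add: has_weak_derivative_alt)
      also have "\<dots> = - (LINT x|lebesgue. h x * \<phi> x)"
        using h \<phi> by (simp add: has_weak_derivative_alt)
      finally show ?thesis by simp
    qed
    ultimately show "(LINT x|lebesgue. (g x - h x) * \<phi> x) = 0"
      by (simp add: left_diff_distrib)
  qed
  then show ?thesis by simp
qed

section \<open>Lipschitz representatives of Sobolev functions\<close>

lemma indefinite_integral_lipschitz:
  fixes g :: "real \<Rightarrow> real"
  assumes g: "g \<in> borel_measurable lebesgue" "\<And>x. \<bar>g x\<bar> \<le> C" and "0 \<le> C"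
  obtains G where "C-lipschitz_on UNIV G" "\<And>a b. a \<le> b \<Longrightarrow> (g has_integral G b - G a) {a..b}"
proof -
  have li: "locally_integrable g"
    using g by (intro locally_integrable_bounded) auto
  have on: "g integrable_on {a..b}" for a b
    using locally_integrable_imp_integrable_on[OF li, of a b] by simp
  \<comment> \<open>This is the oriented integral from 0 to \<open>x\<close>; integrals over
    reversed intervals would be 0, so the sign is put in by hand.\<close>
  define G where "G = (\<lambda>x. if 0 \<le> x then integral {0..x} g else - integral {x..0} g)"
  have comb: "integral {a..c} g = integral {a..b} g + integral {b..c} g" if "a \<le> b" "b \<le> c" for a b c
    using that on by (simp add: Henstock_Kurzweil_Integration.integral_combine)
  have int: "(g has_integral G b - G a) {a..b}" if "a \<le> b" for a b
  proof -
    have "G b - G a = integral {a..b} g"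
      using that comb[of 0 a b] comb[of a 0 b] comb[of a b 0] by (auto simp: G_def)
    then show ?thesis using integrable_integral[OF on[of a b]] by simp
  qed
  have bound: "\<bar>G b - G a\<bar> \<le> C * (b - a)" if "a \<le> b" for a b
    using has_integral_bound_real[OF \<open>0 \<le> C\<close>, of "{}" g "G b - G a" a b] int[OF that] g(2) that by auto
  have "C-lipschitz_on UNIV G"
  proof (rule lipschitz_onI)
    show "dist (G x) (G y) \<le> C * dist x y" for x y
      using bound[of x y] bound[of y x] by (cases "x \<le> y") (auto simp: dist_real_def abs_minus_commute)
  qed (use \<open>0 \<le> C\<close> in auto)
  then show thesis using int by (rule that)
qed

definition bounded_lipschitz :: "(real \<Rightarrow> real) set" where
  "bounded_lipschitz = {f. bounded (range f) \<and> (\<exists>C. C-lipschitz_on UNIV f)}"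

text \<open>The set where two continuous functions agree is closed, and a closed set of full measure
  is the whole line.\<close>

lemma AE_eq_continuous_imp_eq:
  fixes f g :: "real \<Rightarrow> real"
  assumes "continuous_on UNIV f" "continuous_on UNIV g" "AE x in lebesgue. f x = g x"
  shows "f = g"
proof
  fix x
  have "closed {x. f x = g x}"
    using assms(1,2) by (rule closed_Collect_eq)
  then show "f x = g x"
    using mem_closed_if_AE_lebesgue[of "{x. f x = g x}" x] assms(3) by simp
qed

lemma W1_infty_imp_AE_bounded_lipschitz:
  assumes "u \<in> W1_infty"
  obtains f where "f \<in> bounded_lipschitz" "AE x in lebesgue. u x = f x"
proof -
  obtain g0 B C0 where u: "AE x in lebesgue. \<bar>u x\<bar> \<le> B"
    and g0: "g0 \<in> borel_measurable lebesgue" "AE x in lebesgue. \<bar>g0 x\<bar> \<le> C0"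
      "has_weak_derivative u g0"
    using assms by (auto simp: W1_infty_def L_infty_def)
  define C where "C = max C0 0"
  \<comment> \<open>\<open>g0\<close> is only essentially bounded; the truncated version is bounded
    everywhere, so that its indefinite integral is Lipschitz, and it differs from \<open>g0\<close>
    on a null set.\<close>
  define g where "g = (\<lambda>x. max (- C) (min C (g0 x)))"
  have g_meas: "g \<in> borel_measurable lebesgue"
    unfolding g_def using g0(1) by (intro borel_measurable_max borel_measurable_min) auto
  have g_bd: "\<bar>g x\<bar> \<le> C" for x by (auto simp: g_def C_def)
  have g_eq: "AE x in lebesgue. g0 x = g x"
    using g0(2) by eventually_elim (auto simp: g_def C_def)
  obtain G where G: "C-lipschitz_on UNIV G" "\<And>a b. a \<le> b \<Longrightarrow> (g has_integral G b - G a) {a..b}"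
    using indefinite_integral_lipschitz[OF g_meas g_bd] by (auto simp: C_def)
  have li: "locally_integrable u" "locally_integrable g0"
    using g0(3) by (auto simp: has_weak_derivative_alt)
  have li_g: "locally_integrable g"
    using g_bd by (intro locally_integrable_bounded[OF g_meas]) auto
  have li_G: "locally_integrable G"
    by (intro locally_integrable_continuous lipschitz_on_continuous_on[OF G(1)])
  have weak_G: "has_weak_derivative G g"
    using G li_g by (intro lipschitz_has_weak_derivative AE_derivative_of_integral) auto
  have "\<exists>c. AE x in lebesgue. u x - G x = c"
  proof (rule du_Bois_Reymond)
    show "locally_integrable (\<lambda>x. u x - G x)"
      using li(1) li_G by (rule locally_integrable_diff)
    fix \<phi> assume \<phi>: "\<phi> \<in> test_functions"
    obtain r where r: "0 < r" "\<And>x. x \<notin> {-r..r} \<Longrightarrow> \<phi> x = 0"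
      using test_functionsD[OF \<phi>] by blast
    have smooth: "smooth \<phi>" using \<phi> by (rule test_functions_smooth)
    have "integrable lebesgue (\<lambda>x. u x * deriv \<phi> x)" "integrable lebesgue (\<lambda>x. G x * deriv \<phi> x)"
      by (auto intro!: integrable_mult_compact_support[where r = r] li(1) li_G smooth_imp_continuous
        smooth_deriv smooth deriv_test_function_outside r(2))
    moreover have "(LINT x|lebesgue. g0 x * \<phi> x) = (LINT x|lebesgue. g x * \<phi> x)"
    proof (rule integral_cong_AE)
      show "(\<lambda>x. g0 x * \<phi> x) \<in> borel_measurable lebesgue" "(\<lambda>x. g x * \<phi> x) \<in> borel_measurable lebesgue"
        by (intro borel_measurable_times continuous_measurable_lebesgue smooth_imp_continuous
            smooth g0(1) g_meas)+
      show "AE x in lebesgue. g0 x * \<phi> x = g x * \<phi> x"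
        using g_eq by eventually_elim simp
    qed
    ultimately show "(LINT x|lebesgue. (u x - G x) * deriv \<phi> x) = 0"
      using g0(3) weak_G \<phi> by (simp add: has_weak_derivative_alt left_diff_distrib)
  qed
  then obtain c where c: "AE x in lebesgue. u x - G x = c" by blast
  define f where "f = (\<lambda>x. G x + c)"
  have eq: "AE x in lebesgue. u x = f x"
    using c by eventually_elim (simp add: f_def)
  have lip: "C-lipschitz_on UNIV f"
    using lipschitz_on_add[OF G(1) lipschitz_on_constant[of UNIV c]] by (simp add: f_def)
  \<comment> \<open>Boundedness passes from \<open>u\<close> to \<open>f\<close> almost everywhere;
    continuity of \<open>f\<close> then extends it to every point.\<close>
  have "AE x in lebesgue. x \<in> {x. \<bar>f x\<bar> \<le> B}"
    using u eq by eventually_elim simp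
  moreover have "closed {x. \<bar>f x\<bar> \<le> B}"
    by (intro closed_Collect_le continuous_intros lipschitz_on_continuous_on[OF lip])
  ultimately have "\<bar>f x\<bar> \<le> B" for x
    using mem_closed_if_AE_lebesgue by blast
  then have "bounded (range f)"
    by (auto simp: bounded_iff)
  then show thesis
    using lip eq by (intro that[of f]) (auto simp: bounded_lipschitz_def)
qed

lemma bounded_lipschitz_imp_weak_derivative:
  assumes "f \<in> bounded_lipschitz"
  obtains g where "g \<in> L_infty" "has_weak_derivative f g"
    "AE x in lebesgue. (f has_real_derivative g x) (at x)"
proof -
  obtain C where C: "C-lipschitz_on UNIV f"
    using assms by (auto simp: bounded_lipschitz_def)
  obtain g where g: "g \<in> borel_measurable lebesgue" "\<And>x. \<bar>g x\<bar> \<le> C"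
    "AE x in lebesgue. (f has_real_derivative g x) (at x)"
    by (rule lipschitz_AE_derivative[OF C], rule that)
  have "has_weak_derivative f g"
    using g by (intro lipschitz_has_weak_derivative[OF C] locally_integrable_bounded) auto
  moreover have "g \<in> L_infty"
    using g by (auto simp: L_infty_def)
  ultimately show thesis using g(3) by (intro that)
qed

lemma W1_infty_rep_eq: "W1_infty_rep = bounded_lipschitz"
proof (intro equalityI subsetI)
  fix u assume u: "u \<in> W1_infty_rep"
  then obtain f where f: "f \<in> bounded_lipschitz" "AE x in lebesgue. u x = f x"
    using W1_infty_imp_AE_bounded_lipschitz by (auto simp: W1_infty_rep_def)
  have "u = f"
  proof (rule AE_eq_continuous_imp_eq)
    show "continuous_on UNIV u" using u by (simp add: W1_infty_rep_def)
    show "continuous_on UNIV f"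
      using f(1) lipschitz_on_continuous_on by (auto simp: bounded_lipschitz_def)
  qed (rule f(2))
  then show "u \<in> bounded_lipschitz" using f(1) by simp
next
  fix f assume f: "f \<in> bounded_lipschitz"
  then have cont: "continuous_on UNIV f"
    using lipschitz_on_continuous_on by (auto simp: bounded_lipschitz_def)
  obtain B where "\<And>x. \<bar>f x\<bar> \<le> B"
    using f by (auto simp: bounded_lipschitz_def bounded_iff)
  then have "f \<in> L_infty"
    using cont by (auto simp: L_infty_def intro!: continuous_measurable_lebesgue)
  moreover obtain g where "g \<in> L_infty" "has_weak_derivative f g"
    using bounded_lipschitz_imp_weak_derivative[OF f] by blast
  ultimately show "f \<in> W1_infty_rep"
    using cont by (auto simp: W1_infty_rep_def W1_infty_def)
qed

section \<open>The uncertain shift semigroup\<close>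

lemma sup_norm_upper: "bounded (range f) \<Longrightarrow> \<bar>f x\<bar> \<le> sup_norm f"
  unfolding sup_norm_def
  by (rule cSUP_upper) (auto simp: bounded_iff bdd_above_def)

lemma sup_norm_least: "(\<And>x. \<bar>f x\<bar> \<le> c) \<Longrightarrow> sup_norm f \<le> c"
  unfolding sup_norm_def by (rule cSUP_least) auto

lemma bounded_rangeI: "(\<And>x. \<bar>f x :: real\<bar> \<le> B) \<Longrightarrow> bounded (range f)"
  by (auto simp: bounded_iff)

lemma bounded_range_diff:
  fixes f g :: "'a \<Rightarrow> real"
  assumes "bounded (range f)" "bounded (range g)"
  shows "bounded (range (\<lambda>x. f x - g x))"
proof -
  obtain A B where "\<And>x. \<bar>f x\<bar> \<le> A" "\<And>x. \<bar>g x\<bar> \<le> B"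
    using assms by (auto simp: bounded_iff)
  then have "\<bar>f x - g x\<bar> \<le> A + B" for x
    by (intro order_trans[OF abs_triangle_ineq4] add_mono)
  then show ?thesis by (rule bounded_rangeI)
qed

lemma uncertain_shift_upper:
  assumes "bounded (range f)" "\<bar>y\<bar> \<le> t"
  shows "f (x + y) \<le> uncertain_shift t f x"
  unfolding uncertain_shift_def
proof (rule cSUP_upper)
  show "bdd_above ((\<lambda>y. f (x + y)) ` {y. \<bar>y\<bar> \<le> t})"
    using bounded_imp_bdd_above[OF assms(1)] by (rule bdd_above_mono) auto
qed (use assms in simp)

lemma uncertain_shift_least:
  assumes "0 \<le> t" "\<And>y. \<bar>y\<bar> \<le> t \<Longrightarrow> f (x + y) \<le> c"
  shows "uncertain_shift t f x \<le> c"
  unfolding uncertain_shift_def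
  by (rule cSUP_least) (use assms in \<open>auto intro: exI[of _ 0]\<close>)

lemma uncertain_shift_bounded:
  assumes "bounded (range f)" "0 \<le> t"
  shows "bounded (range (uncertain_shift t f))"
proof -
  obtain B where B: "\<And>x. \<bar>f x\<bar> \<le> B"
    using assms(1) by (auto simp: bounded_iff)
  show ?thesis
  proof (rule bounded_rangeI)
    fix x
    have "uncertain_shift t f x \<le> B"
      using B by (intro uncertain_shift_least assms(2)) (auto simp: abs_le_iff)
    moreover have "f (x + 0) \<le> uncertain_shift t f x"
      using assms by (intro uncertain_shift_upper) auto
    ultimately show "\<bar>uncertain_shift t f x\<bar> \<le> B"
      using B[of x] by (auto simp: abs_le_iff)
  qed
qed

section \<open>Difference quotients of the uncertain shift\<close>

lemma diff_quot_bounded: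
  assumes "bounded (range f)" "0 < h"
  shows "bounded (range (diff_quot uncertain_shift h f))"
proof -
  have "bounded (range (\<lambda>x. uncertain_shift h f x - f x))"
    using assms by (intro bounded_range_diff uncertain_shift_bounded) auto
  then obtain B where "\<And>x. \<bar>uncertain_shift h f x - f x\<bar> \<le> B"
    by (auto simp: bounded_iff)
  then have "\<bar>diff_quot uncertain_shift h f x\<bar> \<le> B / h" for x
    using assms(2) by (simp add: diff_quot_def divide_right_mono)
  then show ?thesis by (rule bounded_rangeI)
qed

lemma diff_quot_ge:
  assumes "bounded (range f)" "0 < h" "\<bar>y\<bar> \<le> h"
  shows "f (x + y) - f x \<le> h * diff_quot uncertain_shift h f x"
  using uncertain_shift_upper[OF assms(1,3), of x] assms(2) by (simp add: diff_quot_def)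

lemma diff_quot_le:
  assumes "0 < h" "\<And>y. \<bar>y\<bar> \<le> h \<Longrightarrow> f (x + y) - f x \<le> h * c"
  shows "diff_quot uncertain_shift h f x \<le> c"
proof -
  have "uncertain_shift h f x \<le> f x + h * c"
    using assms by (intro uncertain_shift_least) (auto simp: algebra_simps)
  then show ?thesis
    using assms(1) by (simp add: diff_quot_def divide_le_eq algebra_simps)
qed

text \<open>The supremum of the linear function \<open>D * y\<close> over
  \<open>\<bar>y\<bar> \<le> h\<close> is \<open>\<bar>D\<bar> * h\<close>, and the error is at most
  \<open>e * h\<close>. The same estimate gives pointwise convergence for one \<open>x\<close> and
  uniform convergence if the hypothesis holds for all \<open>x\<close>.\<close>

lemma diff_quot_approx:
  assumes f: "bounded (range f)" and "0 < h"
    and approx: "\<And>y. \<bar>y\<bar> \<le> h \<Longrightarrow> \<bar>f (x + y) - f x - D * y\<bar> \<le> e * \<bar>y\<bar>"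
  shows "\<bar>diff_quot uncertain_shift h f x - \<bar>D\<bar>\<bar> \<le> e"
proof -
  have "0 \<le> e"
    using approx[of h] \<open>0 < h\<close> by (metis abs_ge_zero abs_of_pos order_refl order_trans zero_le_mult_iff not_le)
  have "diff_quot uncertain_shift h f x \<le> \<bar>D\<bar> + e"
  proof (rule diff_quot_le[OF \<open>0 < h\<close>])
    fix y assume y: "\<bar>y\<bar> \<le> h"
    have "f (x + y) - f x \<le> D * y + e * \<bar>y\<bar>"
      using approx[OF y] by (auto simp: abs_le_iff)
    also have "\<dots> \<le> \<bar>D\<bar> * \<bar>y\<bar> + e * \<bar>y\<bar>"
      by (metis abs_ge_self abs_mult add_right_mono)
    also have "\<dots> \<le> (\<bar>D\<bar> + e) * h"
      unfolding distrib_right[symmetric] using y \<open>0 \<le> e\<close> by (intro mult_left_mono) auto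
    finally show "f (x + y) - f x \<le> h * (\<bar>D\<bar> + e)" by (simp add: mult.commute)
  qed
  moreover have "\<bar>D\<bar> - e \<le> diff_quot uncertain_shift h f x"
  proof -
    \<comment> \<open>This is the endpoint at which the linear part attains its maximum.\<close>
    define y where "y = (if 0 \<le> D then h else - h)"
    have y: "\<bar>y\<bar> = h" "D * y = \<bar>D\<bar> * h" using \<open>0 < h\<close> by (auto simp: y_def)
    have "\<bar>D\<bar> * h - e * h \<le> f (x + y) - f x"
      using approx[of y] y by (auto simp: abs_le_iff)
    also have "\<dots> \<le> h * diff_quot uncertain_shift h f x"
      using y by (intro diff_quot_ge f \<open>0 < h\<close>) auto
    finally have "h * (\<bar>D\<bar> - e) \<le> h * diff_quot uncertain_shift h f x"
      by (simp add: algebra_simps)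
    then show ?thesis using \<open>0 < h\<close> by simp
  qed
  ultimately show ?thesis by (simp add: abs_le_iff)
qed

lemma diff_quot_tendsto_abs_derivative:
  assumes f: "bounded (range f)" and D: "(f has_real_derivative D) (at x)"
  shows "((\<lambda>h. diff_quot uncertain_shift h f x) \<longlongrightarrow> \<bar>D\<bar>) (at_right 0)"
proof (rule tendstoI)
  fix e :: real assume "0 < e"
  then obtain s where "s > 0" and s: "\<And>y. y \<noteq> 0 \<Longrightarrow> \<bar>y\<bar> < s \<Longrightarrow> \<bar>(f (x + y) - f x) / y - D\<bar> < e / 2"
    using D unfolding DERIV_def LIM_eq by (metis diff_zero half_gt_zero real_norm_def)
  have approx: "\<bar>f (x + y) - f x - D * y\<bar> \<le> e / 2 * \<bar>y\<bar>" if "\<bar>y\<bar> < s" for y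
  proof (cases "y = 0")
    case False
    have "f (x + y) - f x - D * y = ((f (x + y) - f x) / y - D) * y"
      using False by (simp add: field_simps)
    then have "\<bar>f (x + y) - f x - D * y\<bar> = \<bar>(f (x + y) - f x) / y - D\<bar> * \<bar>y\<bar>"
      by (simp only: abs_mult)
    also have "\<dots> \<le> e / 2 * \<bar>y\<bar>"
      using s[OF False that] by (intro mult_right_mono) auto
    finally show ?thesis .
  qed simp
  have "dist (diff_quot uncertain_shift h f x) \<bar>D\<bar> < e" if "0 < h" "h < s" for h
    using diff_quot_approx[OF f \<open>0 < h\<close>, of x D "e / 2"] approx that \<open>0 < e\<close>
    by (fastforce simp: dist_real_def)
  then show "\<forall>\<^sub>F h in at_right 0. dist (diff_quot uncertain_shift h f x) \<bar>D\<bar> < e"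
    unfolding eventually_at_right_field using \<open>0 < s\<close> by blast
qed

section \<open>The domains of the generator and of the monotone generator\<close>

lemma BUC_abs: "f \<in> BUC \<Longrightarrow> (\<lambda>x. \<bar>f x\<bar>) \<in> BUC"
  using uniformly_continuous_on_norm[of UNIV f] by (auto simp: BUC_def bounded_iff)

text \<open>Uniform continuity of \<open>f'\<close> makes the first-order approximation uniform in
  the base point, so the quotients converge to \<open>\<bar>f' x\<bar>\<close> in norm.\<close>

lemma BUC1_subset_dom_generator: "BUC1 \<subseteq> dom_generator uncertain_shift"
proof
  fix f assume "f \<in> BUC1"
  then obtain f' where f: "f \<in> BUC" and f': "f' \<in> BUC" and
    deriv: "\<And>x. (f has_real_derivative f' x) (at x)"
    by (auto simp: BUC1_def)
  have bdd: "bounded (range f)" using f by (simp add: BUC_def)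
  have "((\<lambda>h. sup_norm (\<lambda>x. diff_quot uncertain_shift h f x - \<bar>f' x\<bar>)) \<longlongrightarrow> 0) (at_right 0)"
  proof (rule tendstoI)
    fix e :: real assume "0 < e"
    have "uniformly_continuous_on UNIV f'" using f' by (simp add: BUC_def)
    then obtain d where "0 < d" and d: "\<And>x y. \<bar>y - x\<bar> < d \<Longrightarrow> \<bar>f' y - f' x\<bar> < e / 2"
      unfolding uniformly_continuous_on_def dist_real_def using \<open>0 < e\<close>
      by (metis UNIV_I half_gt_zero)
    have approx: "\<bar>f (x + y) - f x - f' x * y\<bar> \<le> e / 2 * \<bar>y\<bar>" if "\<bar>y\<bar> \<le> h" "h < d" for x y h
    proof -
      \<comment> \<open>The mean value inequality is applied to \<open>f\<close> minus its linear
        part at \<open>x\<close>, whose derivative \<open>f' z - f' x\<close> is at most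
        \<open>e / 2\<close> in absolute value on the ball.\<close>
      have "norm ((f (x + y) - f' x * (x + y)) - (f x - f' x * x)) \<le> e / 2 * norm (x + y - x)"
      proof (rule field_differentiable_bound[where S = "cball x h" and f' = "\<lambda>z. f' z - f' x"])
        fix z assume "z \<in> cball x h"
        then have "\<bar>z - x\<bar> < d"
          using \<open>h < d\<close> by (simp add: dist_real_def abs_minus_commute)
        then show "norm (f' z - f' x) \<le> e / 2"
          using d[of z x] by simp
        show "((\<lambda>z. f z - f' x * z) has_field_derivative f' z - f' x) (at z within cball x h)"
          by (auto intro!: derivative_eq_intros has_field_derivative_at_within[OF deriv])
      qed (use that in \<open>auto simp: dist_real_def\<close>)
      then show ?thesis by (simp add: algebra_simps)
    qed
    have "dist (sup_norm (\<lambda>x. diff_quot uncertain_shift h f x - \<bar>f' x\<bar>)) 0 < e"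
      if h: "0 < h" "h < d" for h
    proof -
      have le: "\<bar>diff_quot uncertain_shift h f x - \<bar>f' x\<bar>\<bar> \<le> e / 2" for x
        using h approx by (intro diff_quot_approx bdd) auto
      then have "sup_norm (\<lambda>x. diff_quot uncertain_shift h f x - \<bar>f' x\<bar>) \<le> e / 2"
        by (rule sup_norm_least)
      moreover have "0 \<le> sup_norm (\<lambda>x. diff_quot uncertain_shift h f x - \<bar>f' x\<bar>)"
        by (rule order_trans[OF abs_ge_zero sup_norm_upper[OF bounded_rangeI[OF le]]])
      ultimately show ?thesis using \<open>0 < e\<close> by (simp add: dist_real_def)
    qed
    then show "\<forall>\<^sub>F h in at_right 0. dist (sup_norm (\<lambda>x. diff_quot uncertain_shift h f x - \<bar>f' x\<bar>)) 0 < e"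
      unfolding eventually_at_right_field using \<open>0 < d\<close> by blast
  qed
  then show "f \<in> dom_generator uncertain_shift"
    unfolding dom_generator_def mem_Collect_eq using f BUC_abs[OF f']
    by (intro conjI bexI[of _ "\<lambda>x. \<bar>f' x\<bar>"])
qed

lemma step_sequence_inverse: "step_sequence (\<lambda>n. inverse (real (Suc n)))"
  unfolding step_sequence_def
  by (intro conjI LIMSEQ_inverse_real_of_nat) (auto simp: decseq_def field_simps)

lemma step_sequence_at_right:
  assumes "step_sequence h"
  shows "filterlim h (at_right 0) sequentially"
proof -
  have "0 < h n" for n using assms by (simp add: step_sequence_def)
  then show ?thesis
    using assms by (auto simp: step_sequence_def filterlim_at less_imp_neq[symmetric])
qed

text \<open>A uniform limit is a monotone limit: the constant sequence with value \<open>g\<close>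
  decreases to \<open>g\<close>, and convergence as h tends to 0 restricts to every step
  sequence.\<close>

lemma dom_generator_subset_dom_monotone_generator:
  "dom_generator S \<subseteq> dom_monotone_generator S"
proof
  fix f assume "f \<in> dom_generator S"
  then obtain g where f: "f \<in> BUC" and g: "g \<in> BUC" and
    lim: "((\<lambda>h. sup_norm (\<lambda>x. diff_quot S h f x - g x)) \<longlongrightarrow> 0) (at_right 0)"
    by (auto simp: dom_generator_def)
  have dec: "decreases_to (\<lambda>n. g) g"
  proof -
    obtain B where "\<And>x. \<bar>g x\<bar> \<le> B"
      using g by (auto simp: BUC_def bounded_iff)
    then have "\<forall>n x. - B \<le> g x"
      by (meson abs_le_D2 minus_le_iff)
    then show ?thesis by (auto simp: decreases_to_def decseq_def)
  qed
  have "continuous_on UNIV g"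
    using g by (auto simp: BUC_def intro: uniformly_continuous_imp_continuous)
  then have delta: "g \<in> BUC_delta"
    using g dec by (auto simp: BUC_delta_def BUC_def intro!: borel_measurable_continuous_onI exI[of _ "\<lambda>n. g"])
  have "monotone_limit_along S f h g" if "step_sequence h" for h
  proof -
    have "(\<lambda>n. sup_norm (\<lambda>x. diff_quot S (h n) f x - g x)) \<longlonglongrightarrow> 0"
      by (rule filterlim_compose[OF lim step_sequence_at_right[OF that]])
    then show ?thesis
      unfolding monotone_limit_along_def using delta dec g
      by (intro conjI exI[of _ "\<lambda>n. g"]) simp_all
  qed
  then show "f \<in> dom_monotone_generator S"
    using f by (auto simp: dom_monotone_generator_def)
qed

section \<open>From difference quotients to Lipschitz constants\<close>

lemma lipschitz_if_small_increments:
  fixes f :: "real \<Rightarrow> real"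
  assumes \<delta>: "\<And>n. 0 < \<delta> n" "\<delta> \<longlonglongrightarrow> 0"
    and inc: "\<And>n x y. N \<le> n \<Longrightarrow> \<bar>y\<bar> \<le> \<delta> n \<Longrightarrow> f (x + y) - f x \<le> c * \<delta> n"
  shows "c-lipschitz_on UNIV f"
proof -
  have c: "0 \<le> c"
    using inc[of N 0 0] \<delta>(1)[of N] by (simp add: zero_le_mult_iff not_le)
  \<comment> \<open>The lower bound is the hypothesis for the way back, from \<open>x + y\<close> by
    \<open>- y\<close>.\<close>
  have step: "\<bar>f (x + y) - f x\<bar> \<le> c * \<delta> n" if "N \<le> n" "\<bar>y\<bar> \<le> \<delta> n" for n x y
    using inc[OF that, of x] inc[of n "- y" "x + y"] that by (simp add: abs_le_iff)
  have steps: "\<bar>f (x + y) - f x\<bar> \<le> real m * (c * \<delta> n)" if "N \<le> n" "\<bar>y\<bar> \<le> real m * \<delta> n" for n m x y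
    using that(2)
  proof (induction m arbitrary: y)
    case (Suc m)
    \<comment> \<open>The distance is divided into equal pieces, so the induction hypothesis covers
      the first \<open>m\<close> of the \<open>Suc m\<close> pieces.\<close>
    define z where "z = y / real (Suc m)"
    have "real (Suc m) * z = y" by (simp add: z_def del: of_nat_Suc)
    then have z: "y = real m * z + z" by (simp add: distrib_right)
    have "\<bar>z\<bar> \<le> \<delta> n"
      using Suc.prems by (simp add: z_def field_simps)
    then have "\<bar>real m * z\<bar> \<le> real m * \<delta> n"
      by (simp add: abs_mult mult_left_mono)
    then have "\<bar>f (x + real m * z) - f x\<bar> \<le> real m * (c * \<delta> n)"
      by (rule Suc.IH)
    moreover have "\<bar>f (x + real m * z + z) - f (x + real m * z)\<bar> \<le> c * \<delta> n"
      using \<open>N \<le> n\<close> \<open>\<bar>z\<bar> \<le> \<delta> n\<close> by (rule step)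
    ultimately have "\<bar>f (x + (real m * z + z)) - f x\<bar> \<le> real m * (c * \<delta> n) + c * \<delta> n"
      by (simp add: add.assoc)
    then show ?case by (simp add: z[symmetric] distrib_right)
  qed auto
  \<comment> \<open>A short step costs \<open>c * \<delta> n\<close> whatever its length. Covering
    the distance by \<open>m\<close> steps, with \<open>m\<close> rounded up, costs at most
    \<open>c * (\<bar>y\<bar> + \<delta> n)\<close>, and the rounding error disappears in the
    limit.\<close>
  have "\<bar>f (x + y) - f x\<bar> \<le> c * \<bar>y\<bar>" for x y
  proof (rule LIMSEQ_le_const)
    have "(\<lambda>n. c * (\<bar>y\<bar> + \<delta> n)) \<longlonglongrightarrow> c * (\<bar>y\<bar> + 0)"
      by (intro tendsto_intros \<delta>)
    then show "(\<lambda>n. c * (\<bar>y\<bar> + \<delta> n)) \<longlonglongrightarrow> c * \<bar>y\<bar>" by simp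
    have "\<bar>f (x + y) - f x\<bar> \<le> c * (\<bar>y\<bar> + \<delta> n)" if "N \<le> n" for n
    proof -
      define m where "m = nat \<lceil>\<bar>y\<bar> / \<delta> n\<rceil>"
      have m: "\<bar>y\<bar> / \<delta> n \<le> real m" "real m \<le> \<bar>y\<bar> / \<delta> n + 1"
        using \<delta>(1)[of n] by (auto simp: m_def)
      then have "\<bar>y\<bar> \<le> real m * \<delta> n" "real m * \<delta> n \<le> \<bar>y\<bar> + \<delta> n"
        using \<delta>(1)[of n] by (auto simp: field_simps)
      then have "\<bar>f (x + y) - f x\<bar> \<le> real m * (c * \<delta> n)"
        by (intro steps that)
      also have "\<dots> = c * (real m * \<delta> n)" by simp
      also have "\<dots> \<le> c * (\<bar>y\<bar> + \<delta> n)"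
        using c \<open>real m * \<delta> n \<le> \<bar>y\<bar> + \<delta> n\<close> by (rule mult_left_mono[rotated])
      finally show ?thesis .
    qed
    then show "\<exists>N. \<forall>n\<ge>N. \<bar>f (x + y) - f x\<bar> \<le> c * (\<bar>y\<bar> + \<delta> n)" by blast
  qed
  then have "\<bar>f x - f y\<bar> \<le> c * \<bar>x - y\<bar>" for x y
    by (metis diff_add_cancel add.commute)
  then show ?thesis
    using c by (intro lipschitz_onI) (auto simp: dist_real_def)
qed

text \<open>The common criterion for D_L and for the domain of the monotone generator: the latter
  offers an upper bound only eventually, along a given sequence, which is why the hypothesis has
  this form.\<close>

lemma bounded_lipschitz_if_diff_quot_bounded:
  assumes f: "f \<in> BUC" and h: "step_sequence h"
    and le: "\<And>n x. N \<le> n \<Longrightarrow> diff_quot uncertain_shift (h n) f x \<le> c"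
  shows "f \<in> bounded_lipschitz"
proof -
  have pos: "0 < h n" for n using h by (simp add: step_sequence_def)
  have bdd: "bounded (range f)" using f by (simp add: BUC_def)
  have "c-lipschitz_on UNIV f"
  proof (rule lipschitz_if_small_increments[OF pos])
    show "h \<longlonglongrightarrow> 0" using h by (simp add: step_sequence_def)
    fix n x y assume "N \<le> n" "\<bar>y\<bar> \<le> h n"
    then have "f (x + y) - f x \<le> h n * diff_quot uncertain_shift (h n) f x"
      by (intro diff_quot_ge bdd pos)
    also have "\<dots> \<le> h n * c"
      using le[OF \<open>N \<le> n\<close>, of x] pos[of n] by (intro mult_left_mono) auto
    finally show "f (x + y) - f x \<le> c * h n" by (simp add: mult.commute)
  qed
  then show ?thesis using bdd by (auto simp: bounded_lipschitz_def)
qed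

lemma bounded_lipschitz_imp_BUC: "f \<in> bounded_lipschitz \<Longrightarrow> f \<in> BUC"
  by (auto simp: bounded_lipschitz_def BUC_def intro: lipschitz_on_uniformly_continuous)

lemma lipschitz_set_eq: "lipschitz_set uncertain_shift = bounded_lipschitz"
proof (intro equalityI subsetI)
  fix f assume "f \<in> lipschitz_set uncertain_shift"
  then obtain h0 where f: "f \<in> BUC" and "h0 > 0"
    and "bdd_above ((\<lambda>h. sup_norm (diff_quot uncertain_shift h f)) ` {0<..h0})"
    by (auto simp: lipschitz_set_def)
  then obtain M where M: "\<forall>h\<in>{0<..h0}. sup_norm (diff_quot uncertain_shift h f) \<le> M"
    by (auto simp: bdd_above_def)
  \<comment> \<open>From index \<open>N\<close> on, the step sequence stays in
    \<open>{0<..h0}\<close>, where the norm bound holds.\<close>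
  obtain N where N: "inverse (real (Suc N)) < h0"
    using reals_Archimedean[OF \<open>h0 > 0\<close>] by blast
  show "f \<in> bounded_lipschitz"
  proof (rule bounded_lipschitz_if_diff_quot_bounded[OF f step_sequence_inverse])
    fix n x assume "N \<le> n"
    then have le: "inverse (real (Suc n)) \<le> inverse (real (Suc N))"
      by (intro le_imp_inverse_le) auto
    have "diff_quot uncertain_shift (inverse (real (Suc n))) f x
        \<le> sup_norm (diff_quot uncertain_shift (inverse (real (Suc n))) f)"
      using f by (intro order_trans[OF abs_ge_self sup_norm_upper] diff_quot_bounded) (auto simp: BUC_def)
    also have "\<dots> \<le> M"
      using order_trans[OF le less_imp_le[OF N]] by (intro bspec[OF M]) (simp del: of_nat_Suc)
    finally show "diff_quot uncertain_shift (inverse (real (Suc n))) f x \<le> M" .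
  qed
next
  fix f assume f: "f \<in> bounded_lipschitz"
  then obtain C where C: "C-lipschitz_on UNIV f" and bdd: "bounded (range f)"
    by (auto simp: bounded_lipschitz_def)
  have "sup_norm (diff_quot uncertain_shift h f) \<le> C" if "0 < h" for h
  proof (rule sup_norm_least)
    fix x
    have "diff_quot uncertain_shift h f x \<le> C"
    proof (rule diff_quot_le[OF that])
      fix y :: real assume y: "\<bar>y\<bar> \<le> h"
      have "f (x + y) - f x \<le> C * \<bar>y\<bar>"
        using lipschitz_real_bound[OF C, of "x + y" x] by simp
      also have "\<dots> \<le> h * C"
        using y lipschitz_on_nonneg[OF C] by (simp add: mult.commute[of h] mult_left_mono)
      finally show "f (x + y) - f x \<le> h * C" .
    qed
    \<comment> \<open>The admissible shift \<open>y = 0\<close> makes the quotient nonnegative, so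
      the upper bound already bounds its absolute value.\<close>
    moreover have "0 \<le> h * diff_quot uncertain_shift h f x"
      using diff_quot_ge[OF bdd that, of 0 x] that by simp
    then have "0 \<le> diff_quot uncertain_shift h f x"
      using that by (simp add: zero_le_mult_iff)
    ultimately show "\<bar>diff_quot uncertain_shift h f x\<bar> \<le> C" by simp
  qed
  then have "bdd_above ((\<lambda>h. sup_norm (diff_quot uncertain_shift h f)) ` {0<..1})"
    by (intro bdd_aboveI[of _ C]) auto
  then show "f \<in> lipschitz_set uncertain_shift"
    using bounded_lipschitz_imp_BUC[OF f] unfolding lipschitz_set_def
    by (auto intro!: exI[of _ 1])
qed

lemma symmetric_lipschitz_set_eq: "symmetric_lipschitz_set uncertain_shift = bounded_lipschitz"
proof -
  have "(\<lambda>x. - f x) \<in> bounded_lipschitz" if "f \<in> bounded_lipschitz" for f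
    using that by (auto simp: bounded_lipschitz_def bounded_iff)
  then show ?thesis
    unfolding symmetric_lipschitz_set_def lipschitz_set_eq
    using bounded_lipschitz_imp_BUC by blast
qed

text \<open>The bound \<open>B\<close> of the first approximating function bounds all later ones
  from above, and the norm error, eventually below 1, adds the 1 in \<open>B + 1\<close>.\<close>

lemma dom_monotone_generator_subset:
  "dom_monotone_generator uncertain_shift \<subseteq> bounded_lipschitz"
proof
  fix f assume "f \<in> dom_monotone_generator uncertain_shift"
  then obtain gs g where f: "f \<in> BUC" and gs: "\<And>n. gs n \<in> BUC"
    and lim: "(\<lambda>n. sup_norm (\<lambda>x. diff_quot uncertain_shift (inverse (real (Suc n))) f x - gs n x)) \<longlonglongrightarrow> 0"
    and dec: "decreases_to gs g"
    using step_sequence_inverse unfolding dom_monotone_generator_def monotone_limit_along_def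
    by blast
  obtain B where B: "\<And>x. \<bar>gs 0 x\<bar> \<le> B"
    using gs[of 0] by (auto simp: BUC_def bounded_iff)
  have gs_le: "gs n x \<le> B" for n x
  proof -
    have "gs n \<le> gs 0" using dec by (auto simp: decreases_to_def decseq_def)
    then show ?thesis using B[of x] by (meson abs_le_D1 le_fun_def order_trans)
  qed
  obtain N where N: "\<And>n. N \<le> n \<Longrightarrow>
      sup_norm (\<lambda>x. diff_quot uncertain_shift (inverse (real (Suc n))) f x - gs n x) < 1"
    using order_tendstoD(2)[OF lim, of 1] unfolding eventually_sequentially by auto
  show "f \<in> bounded_lipschitz"
  proof (rule bounded_lipschitz_if_diff_quot_bounded[OF f step_sequence_inverse])
    fix n x assume "N \<le> n"
    have "bounded (range (\<lambda>x. diff_quot uncertain_shift (inverse (real (Suc n))) f x - gs n x))"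
      using f gs[of n] by (intro bounded_range_diff diff_quot_bounded) (auto simp: BUC_def)
    from sup_norm_upper[OF this, of x] N[OF \<open>N \<le> n\<close>]
    show "diff_quot uncertain_shift (inverse (real (Suc n))) f x \<le> B + 1"
      using gs_le[of n x] by (simp add: abs_le_iff)
  qed
qed

section \<open>The monotone generator as a pointwise limit\<close>

lemma monotone_limit_along_pointwise:
  assumes f: "bounded (range f)" and h: "step_sequence h"
    and lim: "monotone_limit_along uncertain_shift f h g"
  shows "(\<lambda>n. diff_quot uncertain_shift (h n) f x) \<longlonglongrightarrow> g x"
proof -
  obtain gs where gs: "\<And>n. gs n \<in> BUC" and dec: "decreases_to gs g" and
    norm: "(\<lambda>n. sup_norm (\<lambda>x. diff_quot uncertain_shift (h n) f x - gs n x)) \<longlonglongrightarrow> 0"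
    using lim unfolding monotone_limit_along_def by blast
  have "decseq (\<lambda>n. gs n x)"
    unfolding decseq_def using dec by (metis decreases_to_def decseqD le_funD)
  moreover have "bdd_below (range (\<lambda>n. gs n x))"
  proof -
    obtain c where "\<And>n x. c \<le> gs n x"
      using dec by (auto simp: decreases_to_def)
    then show ?thesis by (intro bdd_belowI2)
  qed
  ultimately have "(\<lambda>n. gs n x) \<longlonglongrightarrow> (INF n. gs n x)"
    by (intro LIMSEQ_decseq_INF)
  then have "(\<lambda>n. gs n x) \<longlonglongrightarrow> g x"
    using dec by (simp add: decreases_to_def)
  moreover have "(\<lambda>n. diff_quot uncertain_shift (h n) f x - gs n x) \<longlonglongrightarrow> 0"
  proof (rule Lim_null_comparison[OF _ norm], intro always_eventually allI)
    fix n
    have "bounded (range (\<lambda>x. diff_quot uncertain_shift (h n) f x - gs n x))"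
      using f gs[of n] h by (intro bounded_range_diff diff_quot_bounded) (auto simp: BUC_def step_sequence_def)
    from sup_norm_upper[OF this, of x]
    show "norm (diff_quot uncertain_shift (h n) f x - gs n x)
        \<le> sup_norm (\<lambda>x. diff_quot uncertain_shift (h n) f x - gs n x)" by simp
  qed
  ultimately show ?thesis
    using tendsto_add by fastforce
qed

text \<open>Terms of \<open>a\<close> and \<open>b\<close> are interleaved into a single step
  sequence \<open>k\<close>. Convergence along \<open>k\<close> forces its even part, taken from
  \<open>a\<close>, and its odd part, taken from \<open>b\<close>, to have the same limit.\<close>

lemma step_sequence_limits_agree:
  fixes q :: "real \<Rightarrow> real"
  assumes conv: "\<And>h. step_sequence h \<Longrightarrow> convergent (\<lambda>n. q (h n))"
    and a: "step_sequence a" "(\<lambda>n. q (a n)) \<longlonglongrightarrow> A"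
    and b: "step_sequence b" "(\<lambda>n. q (b n)) \<longlonglongrightarrow> B"
  shows "A = B"
proof -
  define s where "s = (\<lambda>n::nat. if even n then a else b)"
  have s: "step_sequence (s n)" for n
    using a b by (simp add: s_def)
  \<comment> \<open>Each index is chosen late enough for the next term not to exceed the previous
    one. The choice \<open>m\<close> may fail to be increasing; \<open>n \<le> m n\<close> is what
    sends the indices to infinity.\<close>
  have "\<exists>m. \<forall>n. n \<le> m n \<and> s (Suc n) (m (Suc n)) \<le> s n (m n)"
  proof (rule dependent_nat_choice)
    fix i n :: nat
    have "s (Suc n) \<longlonglongrightarrow> 0" "0 < s n i"
      using s by (auto simp: step_sequence_def)
    then have "\<forall>\<^sub>F j in sequentially. s (Suc n) j < s n i"
      by (rule order_tendstoD)
    then obtain J where J: "\<And>j. J \<le> j \<Longrightarrow> s (Suc n) j < s n i"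
      unfolding eventually_sequentially by blast
    show "\<exists>j\<ge>Suc n. s (Suc n) j \<le> s n i"
      using J[of "max J (Suc n)"] by (intro exI[of _ "max J (Suc n)"]) auto
  qed auto
  then obtain m where m: "\<And>n. n \<le> m n" "\<And>n. s (Suc n) (m (Suc n)) \<le> s n (m n)"
    by blast
  define k where "k = (\<lambda>n. s n (m n))"
  have even: "filterlim (\<lambda>n. m (2 * n)) at_top sequentially"
    and odd: "filterlim (\<lambda>n. m (Suc (2 * n))) at_top sequentially"
    by (rule filterlim_at_top_mono[OF filterlim_ident], rule always_eventually,
        metis m(1) le_add1 mult_2 order_trans le_SucI)+
  have k_even: "k (2 * n) = a (m (2 * n))" and k_odd: "k (Suc (2 * n)) = b (m (Suc (2 * n)))" for n
    by (auto simp: k_def s_def)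
  have sub: "strict_mono (\<lambda>n::nat. 2 * n)" "strict_mono (\<lambda>n::nat. Suc (2 * n))"
    by (auto simp: strict_mono_def)
  have "decseq k"
    unfolding k_def by (rule decseq_SucI) (rule m(2))
  moreover have pos: "0 < k n" for n
    using s[of n] by (simp add: k_def step_sequence_def)
  \<comment> \<open>A decreasing sequence of positive numbers converges, and the even part alone
    identifies its limit.\<close>
  moreover have "k \<longlonglongrightarrow> 0"
  proof -
    obtain L where L: "k \<longlonglongrightarrow> L"
      using decseq_convergent[OF \<open>decseq k\<close>, of 0] pos less_imp_le by metis
    have "(\<lambda>n. a (m (2 * n))) \<longlonglongrightarrow> L"
      using LIMSEQ_subseq_LIMSEQ[OF L sub(1)] by (simp add: comp_def k_even)
    moreover have "(\<lambda>n. a (m (2 * n))) \<longlonglongrightarrow> 0"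
      using a(1) by (intro filterlim_compose[OF _ even]) (simp add: step_sequence_def)
    ultimately show ?thesis using L LIMSEQ_unique by blast
  qed
  ultimately have "step_sequence k" by (simp add: step_sequence_def)
  from conv[OF this] obtain l where l: "(\<lambda>n. q (k n)) \<longlonglongrightarrow> l"
    by (auto simp: convergent_def)
  have "(\<lambda>n. q (a (m (2 * n)))) \<longlonglongrightarrow> l"
    using LIMSEQ_subseq_LIMSEQ[OF l sub(1)] by (simp add: comp_def k_even)
  moreover have "(\<lambda>n. q (a (m (2 * n)))) \<longlonglongrightarrow> A"
    using filterlim_compose[OF a(2) even] .
  moreover have "(\<lambda>n. q (b (m (Suc (2 * n))))) \<longlonglongrightarrow> l"
    using LIMSEQ_subseq_LIMSEQ[OF l sub(2)] by (simp add: comp_def k_odd)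
  moreover have "(\<lambda>n. q (b (m (Suc (2 * n))))) \<longlonglongrightarrow> B"
    using filterlim_compose[OF b(2) odd] .
  ultimately show ?thesis using LIMSEQ_unique by blast
qed

text \<open>This justifies the definite description in \<open>monotone_generator\<close>: a limit
  along a step sequence is determined pointwise by the difference quotients, and interleaving makes
  it the same for all step sequences.\<close>

lemma monotone_generator_pointwise:
  assumes f: "f \<in> dom_monotone_generator uncertain_shift" and h: "step_sequence h"
  shows "(\<lambda>n. diff_quot uncertain_shift (h n) f x) \<longlonglongrightarrow> monotone_generator uncertain_shift f x"
proof -
  have bdd: "bounded (range f)"
    using f by (auto simp: dom_monotone_generator_def BUC_def)
  have ex: "\<exists>g. monotone_limit_along uncertain_shift f a g" if "step_sequence a" for a
    using f that by (auto simp: dom_monotone_generator_def)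
  have conv: "convergent (\<lambda>n. diff_quot uncertain_shift (a n) f y)" if "step_sequence a" for a y
    using ex[OF that] monotone_limit_along_pointwise[OF bdd that] by (auto simp: convergent_def)
  have agree: "g = g'" if "step_sequence a" "monotone_limit_along uncertain_shift f a g"
    "step_sequence b" "monotone_limit_along uncertain_shift f b g'" for a b g g'
  proof
    fix y
    show "g y = g' y"
      by (rule step_sequence_limits_agree[where q = "\<lambda>t. diff_quot uncertain_shift t f y",
          OF conv that(1) monotone_limit_along_pointwise[OF bdd that(1,2)]
          that(3) monotone_limit_along_pointwise[OF bdd that(3,4)]])
  qed
  obtain g where g: "monotone_limit_along uncertain_shift f h g" using ex[OF h] by blast
  have all: "\<forall>a. step_sequence a \<longrightarrow> monotone_limit_along uncertain_shift f a g"
    using ex agree[OF h g] by blast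
  have "monotone_generator uncertain_shift f = g"
    unfolding monotone_generator_def using all agree[OF h g h] h by (intro the_equality) auto
  then show ?thesis
    using monotone_limit_along_pointwise[OF bdd h g] by simp
qed

lemma monotone_generator_eq_abs_derivative:
  assumes f: "f \<in> dom_monotone_generator uncertain_shift"
    and D: "(f has_real_derivative D) (at x)"
  shows "monotone_generator uncertain_shift f x = \<bar>D\<bar>"
proof -
  have bdd: "bounded (range f)"
    using f by (auto simp: dom_monotone_generator_def BUC_def)
  from filterlim_compose[OF diff_quot_tendsto_abs_derivative[OF bdd D]
      step_sequence_at_right[OF step_sequence_inverse]]
  show ?thesis
    using monotone_generator_pointwise[OF f step_sequence_inverse] LIMSEQ_unique by blast
qed

section \<open>Invariance under the semigroup and the chain of inclusions\<close>

lemma uncertain_shift_bounded_lipschitz: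
  assumes "f \<in> bounded_lipschitz" "0 \<le> t"
  shows "uncertain_shift t f \<in> bounded_lipschitz"
proof -
  obtain C where C: "C-lipschitz_on UNIV f" and bdd: "bounded (range f)"
    using assms(1) by (auto simp: bounded_lipschitz_def)
  have le: "uncertain_shift t f x \<le> uncertain_shift t f z + C * \<bar>x - z\<bar>" for x z
  proof (rule uncertain_shift_least[OF assms(2)])
    fix y assume "\<bar>y\<bar> \<le> t"
    then have "f (z + y) \<le> uncertain_shift t f z"
      by (rule uncertain_shift_upper[OF bdd])
    then show "f (x + y) \<le> uncertain_shift t f z + C * \<bar>x - z\<bar>"
      using lipschitz_real_bound[OF C, of "x + y" "z + y"] by (auto simp: abs_le_iff)
  qed
  have "C-lipschitz_on UNIV (uncertain_shift t f)"
  proof (rule lipschitz_onI)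
    show "dist (uncertain_shift t f x) (uncertain_shift t f z) \<le> C * dist x z" for x z
      using le[of x z] le[of z x] by (auto simp: dist_real_def abs_le_iff abs_minus_commute)
  qed (rule lipschitz_on_nonneg[OF C])
  then show ?thesis
    using uncertain_shift_bounded[OF bdd assms(2)] by (auto simp: bounded_lipschitz_def)
qed

text \<open>The clause with unique existence expresses the identification of a Sobolev class with
  its Lipschitz representative; the last clause ranges over every version of the weak
  derivative.\<close>

theorem proposition5p3:
  "BUC1 \<subseteq> dom_generator uncertain_shift
   \<and> dom_generator uncertain_shift \<subseteq> dom_monotone_generator uncertain_shift
   \<and> dom_monotone_generator uncertain_shift \<subseteq> lipschitz_set uncertain_shift
   \<and> lipschitz_set uncertain_shift = symmetric_lipschitz_set uncertain_shift
   \<and> symmetric_lipschitz_set uncertain_shift = W1_infty_rep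
   \<and> (\<forall>u \<in> W1_infty. \<exists>!f. f \<in> symmetric_lipschitz_set uncertain_shift \<and>
         (AE x in lebesgue. u x = f x))
   \<and> (\<forall>f \<in> W1_infty_rep. \<forall>t\<ge>0. uncertain_shift t f \<in> W1_infty_rep)
   \<and> (\<forall>f \<in> dom_monotone_generator uncertain_shift. \<forall>f'. has_weak_derivative f f' \<longrightarrow>
         (AE x in lebesgue. monotone_generator uncertain_shift f x = \<bar>f' x\<bar>))"
  unfolding lipschitz_set_eq symmetric_lipschitz_set_eq W1_infty_rep_eq
proof (intro conjI ballI allI impI BUC1_subset_dom_generator
    dom_generator_subset_dom_monotone_generator dom_monotone_generator_subset refl
    uncertain_shift_bounded_lipschitz)
  fix u assume "u \<in> W1_infty"
  then obtain f where f: "f \<in> bounded_lipschitz" "AE x in lebesgue. u x = f x"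
    by (rule W1_infty_imp_AE_bounded_lipschitz)
  show "\<exists>!f. f \<in> bounded_lipschitz \<and> (AE x in lebesgue. u x = f x)"
  proof (rule ex1I[of _ f])
    fix g assume g: "g \<in> bounded_lipschitz \<and> (AE x in lebesgue. u x = g x)"
    then have "AE x in lebesgue. u x = g x" by simp
    with f(2) have "AE x in lebesgue. g x = f x"
      by eventually_elim simp
    with f(1) g show "g = f"
      by (intro AE_eq_continuous_imp_eq) (auto simp: bounded_lipschitz_def lipschitz_on_continuous_on)
  qed (use f in simp)
next
  fix f f' assume f: "f \<in> dom_monotone_generator uncertain_shift" and f': "has_weak_derivative f f'"
  \<comment> \<open>\<open>g\<close> is at once a weak derivative and, almost everywhere, the
    pointwise derivative; it mediates between \<open>f'\<close> and the limit of the difference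
    quotients.\<close>
  obtain g where g: "has_weak_derivative f g" "AE x in lebesgue. (f has_real_derivative g x) (at x)"
    using bounded_lipschitz_imp_weak_derivative f dom_monotone_generator_subset by blast
  from weak_derivative_unique[OF f' g(1)] g(2)
  show "AE x in lebesgue. monotone_generator uncertain_shift f x = \<bar>f' x\<bar>"
    by eventually_elim (simp add: monotone_generator_eq_abs_derivative[OF f])
qed

end
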